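(* Let $(X,\|\cdot\|)$ be an extended normed linear space and let $Y$ be a closed subspace of $X$. Then $(X,\|\cdot\|)$ is reflexive if and only if both $(Y,\|\cdot\|)$ and the quotient space $(X/Y,\|\cdot\|_q)$ are reflexive, where $\|x+Y\|_q=\inf\{\|x-y\|:y\in Y\}$.
   Context: Vector spaces are over $\mathbb{K}\in\{\mathbb{R},\mathbb{C}\}$. An extended norm on a vector space $X$ is a function $\|\cdot\|:X\to[0,\infty]$ with $\|\alpha x\|=|\alpha|\|x\|$ (convention $0\cdot\infty=0$), $\|x+y\|\le\|x\|+\|y\|$, and $\|x\|=0$ only for $x=0$; $(X,\|\cdot\|)$ is then an extended normed linear space (enls), topologized by the metric $\min\{\|x-y\|,1\}$. $Y$ carries the restriction of $\|\cdot\|$. $X^*$ denotes the space of continuous linear functionals on $X$. A set $A\subseteq X$ is bounded if for every neighborhood $U$ of $0$ there are $r>0$ and a finite set $F\subseteq X$ with $A\subseteq F+rU$ (for a conventional locally convex space this is ordinary boundedness). $\tau_{ucb}$ is the locally convex topology on $X^*$ induced by the seminorms $\phi\mapsto\sup_{x\in B}|\phi(x)|$, $B$ bounded in $X$. The canonical map is $J:X\to(X^*,\tau_{ucb})^*$, $J(x)(f)=f(x)$. The space $X$ is reflexive if $J$ is surjective and continuous when $(X^*,\tau_{ucb})^*$ carries the topology of uniform convergence on bounded subsets of $(X^*,\tau_{ucb})$. *)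

theory Defs
  imports
    "HOL-Analysis.Analysis"
    "HOL-Algebra.Module"
    "HOL-Algebra.AbelCoset"
    "HOL-Decision_Procs.Algebra_Aux"
begin

text \<open>
  A vector space over a field given by a type \<open>'k\<close> is a module in the sense of \<^theory>\<open>HOL-Algebra.Module\<close>
  over \<^const>\<open>cring_class_ops\<close>, the ring record of the type \<open>'k\<close>.  Spaces have explicit
  carriers, so that a subspace, a quotient and a dual of a space are again spaces.  (The \<open>mult\<close>
  and \<open>one\<close> fields that module records inherit from ring records play no role.)

  The definitions make sense for any \<open>'k :: real_normed_field\<close>; the intended instances
  are \<^typ>\<open>real\<close> and \<^typ>\<open>complex\<close>.
\<close>

section \<open>Extended normed linear spaces\<close>

record ('k, 'a) enorm_space = "('k, 'a) module" +
  enorm :: "'a \<Rightarrow> ennreal"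

text \<open>In \<^typ>\<open>ennreal\<close> one has \<open>0 * \<infinity> = 0\<close>; hence \<open>enorm_smult\<close> with \<open>c = 0\<close> yields \<open>enorm X \<zero> = 0\<close>.\<close>

locale enls = module "cring_class_ops :: 'k ring" X
  for X :: "('k::real_normed_field, 'a) enorm_space" (structure) +
  assumes enorm_smult:
      "x \<in> carrier X \<Longrightarrow> enorm X (c \<odot> x) = ennreal (norm c) * enorm X x"
    and enorm_triangle:
      "\<lbrakk>x \<in> carrier X; y \<in> carrier X\<rbrakk> \<Longrightarrow> enorm X (x \<oplus> y) \<le> enorm X x + enorm X y"
    and enorm_eq_0D:
      "\<lbrakk>x \<in> carrier X; enorm X x = 0\<rbrakk> \<Longrightarrow> x = \<zero>"

text \<open>The value \<open>0\<close> outside the carrier is there because \<^const>\<open>Metric_space\<close> requires symmetry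
  on the whole type; it does not affect the topology.\<close>

definition enls_dist :: "('k, 'a) enorm_space \<Rightarrow> 'a \<Rightarrow> 'a \<Rightarrow> real" where
  "enls_dist X x y =
     (if x \<in> carrier X \<and> y \<in> carrier X then enn2real (min (enorm X (x \<ominus>\<^bsub>X\<^esub> y)) 1) else 0)"

definition enls_topology :: "('k, 'a) enorm_space \<Rightarrow> 'a topology" where
  "enls_topology X = Metric_space.mtopology (carrier X) (enls_dist X)"

definition sub_enls :: "('k, 'a) enorm_space \<Rightarrow> 'a set \<Rightarrow> ('k, 'a) enorm_space" where
  "sub_enls X Y = X\<lparr>carrier := Y\<rparr>"

text \<open>The elements of the quotient are the cosets \<open>Y +> x\<close>.  The scalar multiple of a coset \<open>C\<close> is
  \<open>c C + Y\<close>; adding \<open>Y\<close> only matters for \<open>c = 0\<close>.  The elements of the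
  coset \<open>Y +> x\<close> are the differences \<open>x \<ominus> y\<close> with \<open>y \<in> Y\<close>, so \<open>enorm\<close> is the usual
  quotient norm; see \<open>enorm_quot_enls\<close> below.\<close>

definition quot_enls :: "('k, 'a) enorm_space \<Rightarrow> 'a set \<Rightarrow> ('k, 'a set) enorm_space" where
  "quot_enls X Y =
     \<lparr>carrier = a_rcosets\<^bsub>X\<^esub> Y, mult = undefined, one = undefined,
      zero = Y, add = set_add X,
      smult = (\<lambda>c C. Y <+>\<^bsub>X\<^esub> ((\<lambda>x. c \<odot>\<^bsub>X\<^esub> x) ` C)),
      enorm = (\<lambda>C. INF z\<in>C. enorm X z)\<rparr>"


section \<open>Bounded sets, duals and reflexivity\<close>

text \<open>Here \<open>T\<close> is a topology on the carrier of \<open>V\<close>.\<close>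

definition bounded_in ::
    "('k::real_normed_field, 'a, 'm) module_scheme \<Rightarrow> 'a topology \<Rightarrow> 'a set \<Rightarrow> bool" where
  "bounded_in V T A \<longleftrightarrow>
     A \<subseteq> carrier V \<and>
     (\<forall>U. U \<subseteq> carrier V \<and> (\<exists>W. openin T W \<and> \<zero>\<^bsub>V\<^esub> \<in> W \<and> W \<subseteq> U) \<longrightarrow>
        (\<exists>r>0. \<exists>F. finite F \<and> F \<subseteq> carrier V \<and>
           A \<subseteq> F <+>\<^bsub>V\<^esub> ((\<lambda>u. of_real r \<odot>\<^bsub>V\<^esub> u) ` U)))"

text \<open>Functionals are restricted to the carrier (\<^const>\<open>extensional\<close>), so that equality of
  functionals on the carrier is equality of functions.\<close>

definition linear_functional ::
    "('k::real_normed_field, 'a, 'm) module_scheme \<Rightarrow> ('a \<Rightarrow> 'k) \<Rightarrow> bool" where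
  "linear_functional V \<phi> \<longleftrightarrow>
     \<phi> \<in> extensional (carrier V) \<and>
     (\<forall>x\<in>carrier V. \<forall>y\<in>carrier V. \<phi> (x \<oplus>\<^bsub>V\<^esub> y) = \<phi> x + \<phi> y) \<and>
     (\<forall>c. \<forall>x\<in>carrier V. \<phi> (c \<odot>\<^bsub>V\<^esub> x) = c * \<phi> x)"

definition dual ::
    "('k::real_normed_field, 'a, 'm) module_scheme \<Rightarrow> 'a topology \<Rightarrow> ('k, 'a \<Rightarrow> 'k) module" where
  "dual V T =
     \<lparr>carrier = {\<phi>. linear_functional V \<phi> \<and> continuous_map T euclidean \<phi>},
      mult = undefined, one = undefined,
      zero = (\<lambda>x\<in>carrier V. 0),
      add = (\<lambda>\<phi> \<psi>. \<lambda>x\<in>carrier V. \<phi> x + \<psi> x),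
      smult = (\<lambda>c \<phi>. \<lambda>x\<in>carrier V. c * \<phi> x)\<rparr>"

text \<open>The supremum is taken in \<^typ>\<open>ennreal\<close>, where the supremum of the empty set is \<open>0\<close>.\<close>

definition sup_seminorm :: "'a set \<Rightarrow> ('a \<Rightarrow> 'k::real_normed_field) \<Rightarrow> ennreal" where
  "sup_seminorm B \<phi> = (SUP x\<in>B. ennreal (norm (\<phi> x)))"

text \<open>The topology on the dual of uniform convergence on the bounded sets, generated by the open
  balls of the seminorms \<^term>\<open>sup_seminorm B\<close> with \<open>B\<close> bounded.\<close>

definition ucb_topology ::
    "('k::real_normed_field, 'a, 'm) module_scheme \<Rightarrow> 'a topology \<Rightarrow> ('a \<Rightarrow> 'k) topology" where
  "ucb_topology V T = topology_generated_by
     {{\<psi> \<in> carrier (dual V T). sup_seminorm B (\<lambda>x. \<psi> x - \<phi> x) < ennreal \<epsilon>} | B \<phi> \<epsilon>.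
        bounded_in V T B \<and> \<phi> \<in> carrier (dual V T) \<and> \<epsilon> > 0}"

abbreviation bidual ::
    "('k::real_normed_field, 'a, 'm) module_scheme \<Rightarrow> 'a topology
       \<Rightarrow> ('k, ('a \<Rightarrow> 'k) \<Rightarrow> 'k) module" where
  "bidual V T \<equiv> dual (dual V T) (ucb_topology V T)"

abbreviation bidual_topology ::
    "('k::real_normed_field, 'a, 'm) module_scheme \<Rightarrow> 'a topology
       \<Rightarrow> (('a \<Rightarrow> 'k) \<Rightarrow> 'k) topology" where
  "bidual_topology V T \<equiv> ucb_topology (dual V T) (ucb_topology V T)"

definition canonical_map ::
    "('k::real_normed_field, 'a, 'm) module_scheme \<Rightarrow> 'a topology \<Rightarrow> 'a \<Rightarrow> ('a \<Rightarrow> 'k) \<Rightarrow> 'k" where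
  "canonical_map V T x = (\<lambda>\<phi>\<in>carrier (dual V T). \<phi> x)"

definition reflexive_enls :: "('k::real_normed_field, 'a) enorm_space \<Rightarrow> bool" where
  "reflexive_enls X \<longleftrightarrow>
     (let T = enls_topology X; J = canonical_map X T in
        J ` carrier X = carrier (bidual X T) \<and>
        continuous_map T (bidual_topology X T) J)"


section \<open>Basic facts about the definitions\<close>

lemma (in enls) enorm_zero: "enorm X \<zero> = 0"
  using enorm_smult[of \<zero> 0] smult_l_null[of \<zero>] by (simp add: cring_class_ops_def)

lemma (in enls) smult_minus_one:
  assumes "x \<in> carrier X" shows "(- 1) \<odot> x = \<ominus> x"
proof -
  have "\<ominus>\<^bsub>cring_class_ops\<^esub> (1::'k) = - 1"
    by (simp add: uminus_class)
  then show ?thesis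
    using smult_l_minus[of 1 x] assms smult_one[of x] by (simp add: carrier_class one_class)
qed

lemma (in enls) enorm_minus:
  assumes "x \<in> carrier X" shows "enorm X (\<ominus> x) = enorm X x"
  using enorm_smult[OF assms, of "- 1"] by (simp add: smult_minus_one assms)

lemma (in enls) enls_dist_Metric_space: "Metric_space (carrier X) (enls_dist X)"
proof
  fix x y z
  show "0 \<le> enls_dist X x y" by (simp add: enls_dist_def)
  show "enls_dist X x y = enls_dist X y x"
    using enorm_minus[of "x \<ominus> y"] by (auto simp: enls_dist_def M.minus_add M.minus_minus a_minus_def M.a_comm)
  { assume xy: "x \<in> carrier X" "y \<in> carrier X"
    have "enls_dist X x y = 0 \<longleftrightarrow> enorm X (x \<ominus> y) = 0"
      using xy by (auto simp: enls_dist_def enn2real_eq_0_iff min_def top_unique split: if_splits)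
    also have "\<dots> \<longleftrightarrow> x \<ominus> y = \<zero>"
      using xy enorm_eq_0D[of "x \<ominus> y"] enorm_zero by auto
    also have "\<dots> \<longleftrightarrow> x = y"
      using xy M.minus_equality[of x "\<ominus> y"] M.r_neg by (auto simp: a_minus_def)
    finally show "enls_dist X x y = 0 \<longleftrightarrow> x = y" . }
  { assume xyz: "x \<in> carrier X" "y \<in> carrier X" "z \<in> carrier X"
    have "x \<ominus> z = (x \<ominus> y) \<oplus> (y \<ominus> z)"
      using xyz by (simp add: a_minus_def M.a_assoc M.r_neg1)
    then have "enorm X (x \<ominus> z) \<le> enorm X (x \<ominus> y) + enorm X (y \<ominus> z)"
      using xyz enorm_triangle[of "x \<ominus> y" "y \<ominus> z"] by simp
    then have "min (enorm X (x \<ominus> z)) 1 \<le> min (enorm X (x \<ominus> y)) 1 + min (enorm X (y \<ominus> z)) 1"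
      by (auto simp: min_def add_increasing add_increasing2 split: if_splits intro: order_trans)
    moreover have "min (enorm X a) 1 < top_class.top" for a
      by (simp add: min_less_iff_disj)
    ultimately show "enls_dist X x z \<le> enls_dist X x y + enls_dist X y z"
      using xyz unfolding enls_dist_def
      by (simp add: enn2real_plus[symmetric] enn2real_mono) }
qed

lemma (in enls) enorm_quot_enls:
  assumes "submodule Y cring_class_ops X" "x \<in> carrier X"
  shows "enorm (quot_enls X Y) (Y +> x) = (INF y\<in>Y. enorm X (x \<ominus> y))"
proof -
  have Y: "Y \<subseteq> carrier X" "\<And>a. a \<in> Y \<Longrightarrow> \<ominus> a \<in> Y"
    using submoduleE[OF assms(1)] by auto
  have "Y +> x = (\<lambda>y. x \<ominus> y) ` Y"
  proof
    show "Y +> x \<subseteq> (\<lambda>y. x \<ominus> y) ` Y"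
    proof
      fix z assume "z \<in> Y +> x"
      then obtain h where h: "h \<in> Y" "z = h \<oplus> x" by (auto simp: a_r_coset_def')
      then have "z = x \<ominus> (\<ominus> h)" using Y assms(2) by (auto simp: a_minus_def M.a_comm subset_iff)
      then show "z \<in> (\<lambda>y. x \<ominus> y) ` Y" using Y h by blast
    qed
    show "(\<lambda>y. x \<ominus> y) ` Y \<subseteq> Y +> x"
    proof
      fix z assume "z \<in> (\<lambda>y. x \<ominus> y) ` Y"
      then obtain y where y: "y \<in> Y" "z = x \<ominus> y" by blast
      then have "z = \<ominus> y \<oplus> x" using Y assms(2) by (auto simp: a_minus_def M.a_comm subset_iff)
      then show "z \<in> Y +> x" using Y y by (auto simp: a_r_coset_def')
    qed
  qed
  then show ?thesis by (simp add: quot_enls_def image_image)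
qed

lemma (in enls) openin_enls_topology:
  "openin (enls_topology X) U \<longleftrightarrow>
     U \<subseteq> carrier X \<and>
     (\<forall>x\<in>U. \<exists>r>0. \<forall>y\<in>carrier X. enorm X (x \<ominus> y) < ennreal r \<longrightarrow> y \<in> U)"
proof -
  interpret D: Metric_space "carrier X" "enls_dist X" by (rule enls_dist_Metric_space)
  have less: "enls_dist X x y < s \<longleftrightarrow> enorm X (x \<ominus> y) < ennreal s"
    if "x \<in> carrier X" "y \<in> carrier X" "0 < s" "s \<le> 1" for x y s
  proof -
    have "enls_dist X x y < s \<longleftrightarrow> min (enorm X (x \<ominus> y)) 1 < ennreal s"
    proof -
      have "min (enorm X (x \<ominus> y)) 1 < top_class.top" by (simp add: min_less_iff_disj)
      then obtain t where t: "0 \<le> t" "min (enorm X (x \<ominus> y)) 1 = ennreal t"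
        by (cases "min (enorm X (x \<ominus> y)) 1") auto
      then show ?thesis using that by (simp add: enls_dist_def ennreal_less_iff)
    qed
    also have "\<dots> \<longleftrightarrow> enorm X (x \<ominus> y) < ennreal s"
    proof -
      have "\<not> 1 < ennreal s" using that by (simp add: ennreal_le_1 not_less)
      then show ?thesis by (simp add: min_less_iff_disj)
    qed
    finally show ?thesis .
  qed
  have "(\<exists>r>0. D.mball x r \<subseteq> U) \<longleftrightarrow>
        (\<exists>r>0. \<forall>y\<in>carrier X. enorm X (x \<ominus> y) < ennreal r \<longrightarrow> y \<in> U)" (is "?L \<longleftrightarrow> ?R")
    if "x \<in> carrier X" for x
  proof
    assume ?L
    then obtain r where r: "r > 0" "D.mball x r \<subseteq> U" by blast
    have "y \<in> U" if y: "y \<in> carrier X" "enorm X (x \<ominus> y) < ennreal (min r 1)" for y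
    proof -
      have "enls_dist X x y < min r 1"
        using y less[of x y "min r 1"] \<open>x \<in> carrier X\<close> r by simp
      then show ?thesis using r y \<open>x \<in> carrier X\<close> by auto
    qed
    then show ?R using r by (intro exI[of _ "min r 1"]) auto
  next
    assume ?R
    then obtain r where r: "r > 0"
      "\<And>y. \<lbrakk>y \<in> carrier X; enorm X (x \<ominus> y) < ennreal r\<rbrakk> \<Longrightarrow> y \<in> U" by blast
    have "D.mball x (min r 1) \<subseteq> U"
    proof
      fix y assume "y \<in> D.mball x (min r 1)"
      then have y: "y \<in> carrier X" "enls_dist X x y < min r 1" by auto
      then have "enorm X (x \<ominus> y) < ennreal (min r 1)"
        using less[of x y "min r 1"] \<open>x \<in> carrier X\<close> r by simp
      also have "\<dots> \<le> ennreal r" by (simp add: ennreal_leI)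
      finally show "y \<in> U" using r y by blast
    qed
    then show ?L using r by (intro exI[of _ "min r 1"]) auto
  qed
  then show ?thesis
    unfolding enls_topology_def D.openin_mtopology by blast
qed

lemma (in enls) topspace_enls_topology: "topspace (enls_topology X) = carrier X"
proof -
  interpret D: Metric_space "carrier X" "enls_dist X" by (rule enls_dist_Metric_space)
  show ?thesis by (simp add: enls_topology_def)
qed

lemma (in enls) enls_sub_enls:
  assumes "submodule Y cring_class_ops X"
  shows "enls (sub_enls X Y)"
proof -
  have Y: "Y \<subseteq> carrier X" using submoduleE[OF assms] by auto
  have "module cring_class_ops (sub_enls X Y)"
    unfolding sub_enls_def using submodule.submodule_is_module[OF assms] module_axioms .
  moreover have "enls_axioms (sub_enls X Y)"
    using Y enorm_smult enorm_triangle enorm_eq_0D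
    by unfold_locales (auto simp: sub_enls_def subset_iff)
  ultimately show ?thesis by (rule enls.intro)
qed

lemma (in enls) quot_enls_simps:
  assumes Y: "submodule Y cring_class_ops X"
  shows "carrier (quot_enls X Y) = (\<lambda>x. Y +> x) ` carrier X"
    and "\<zero>\<^bsub>quot_enls X Y\<^esub> = Y +> \<zero>"
    and "\<lbrakk>x \<in> carrier X; y \<in> carrier X\<rbrakk> \<Longrightarrow>
           (Y +> x) \<oplus>\<^bsub>quot_enls X Y\<^esub> (Y +> y) = Y +> (x \<oplus> y)"
    and "x \<in> carrier X \<Longrightarrow> c \<odot>\<^bsub>quot_enls X Y\<^esub> (Y +> x) = Y +> (c \<odot> x)"
proof -
  have sub: "Y \<subseteq> carrier X" "\<zero> \<in> Y" "\<And>a b. \<lbrakk>a \<in> Y; b \<in> Y\<rbrakk> \<Longrightarrow> a \<oplus> b \<in> Y"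
    "\<And>c a. a \<in> Y \<Longrightarrow> c \<odot> a \<in> Y"
    using submoduleE[OF Y] subgroup.one_closed[OF submodule.axioms(1)[OF Y]]
    by (auto simp: carrier_class)
  interpret S: abelian_subgroup Y X
    by (rule abelian_subgroupI3[OF _ M.abelian_group_axioms])
      (simp add: additive_subgroup.intro submodule.axioms(1)[OF Y])
  show "carrier (quot_enls X Y) = (\<lambda>x. Y +> x) ` carrier X"
    by (auto simp: quot_enls_def A_RCOSETS_def')
  show "\<zero>\<^bsub>quot_enls X Y\<^esub> = Y +> \<zero>"
    using sub by (auto simp: quot_enls_def a_r_coset_def' subset_iff)
  show "(Y +> x) \<oplus>\<^bsub>quot_enls X Y\<^esub> (Y +> y) = Y +> (x \<oplus> y)"
    if "x \<in> carrier X" "y \<in> carrier X"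
    using that S.a_rcos_sum by (simp add: quot_enls_def)
  show "c \<odot>\<^bsub>quot_enls X Y\<^esub> (Y +> x) = Y +> (c \<odot> x)" if x: "x \<in> carrier X"
  proof -
    have "Y <+>\<^bsub>X\<^esub> ((\<lambda>x. c \<odot> x) ` (Y +> x)) = Y +> (c \<odot> x)"
    proof
      show "Y <+>\<^bsub>X\<^esub> ((\<lambda>x. c \<odot> x) ` (Y +> x)) \<subseteq> Y +> (c \<odot> x)"
      proof
        fix z assume "z \<in> Y <+>\<^bsub>X\<^esub> ((\<lambda>x. c \<odot> x) ` (Y +> x))"
        then obtain h k where hk: "h \<in> Y" "k \<in> Y" "z = h \<oplus> c \<odot> (k \<oplus> x)"
          by (auto simp: set_add_def' a_r_coset_def')
        then have "h \<in> carrier X" "k \<in> carrier X" using sub by auto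
        then have "z = (h \<oplus> c \<odot> k) \<oplus> c \<odot> x"
          using hk x by (simp add: smult_r_distr carrier_class M.a_assoc)
        then show "z \<in> Y +> (c \<odot> x)" using sub hk by (auto simp: a_r_coset_def')
      qed
      show "Y +> (c \<odot> x) \<subseteq> Y <+>\<^bsub>X\<^esub> ((\<lambda>x. c \<odot> x) ` (Y +> x))"
      proof
        fix z assume "z \<in> Y +> (c \<odot> x)"
        then obtain h where h: "h \<in> Y" "z = h \<oplus> c \<odot> x" by (auto simp: a_r_coset_def')
        moreover have "x \<in> Y +> x" using sub x by (force simp: a_r_coset_def')
        ultimately show "z \<in> Y <+>\<^bsub>X\<^esub> ((\<lambda>x. c \<odot> x) ` (Y +> x))" by (auto simp: set_add_def')
      qed
    qed
    then show ?thesis by (simp add: quot_enls_def)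
  qed
qed

lemma INF_mult_ennreal:
  fixes f :: "'b \<Rightarrow> ennreal" assumes "0 < a"
  shows "(INF y\<in>A. ennreal a * f y) = ennreal a * (INF y\<in>A. f y)"
proof -
  have 1: "ennreal a * (ennreal (1 / a) * x) = x" "ennreal (1 / a) * (ennreal a * x) = x" for x
    using assms by (simp_all flip: mult.assoc ennreal_mult)
  have "bij (\<lambda>x. ennreal a * x)"
    by (rule o_bij[of "\<lambda>x. ennreal (1 / a) * x"]) (auto simp: fun_eq_iff 1)
  moreover have "mono (\<lambda>x. ennreal a * x)" by (auto intro!: monoI mult_left_mono)
  ultimately show ?thesis using mono_bij_Inf[of "\<lambda>x. ennreal a * x" "f ` A"] by (simp add: image_image)
qed

lemma le_INF_add_ennreal:
  fixes f g :: "_ \<Rightarrow> ennreal"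
  assumes le: "\<And>v w. \<lbrakk>v \<in> A; w \<in> B\<rbrakk> \<Longrightarrow> a \<le> f v + g w"
  shows "a \<le> (INF v\<in>A. f v) + (INF w\<in>B. g w)"
proof (rule ennreal_le_epsilon)
  fix e :: real
  assume fin: "(INF v\<in>A. f v) + (INF w\<in>B. g w) < top_class.top" and e: "0 < e"
  obtain v where v: "v \<in> A" "f v < (INF v\<in>A. f v) + ennreal (e / 2)"
    using INF_approx_ennreal[of "e / 2" _ f A, OF _ refl] fin e
    by (metis ennreal_add_eq_top half_gt_zero infinity_ennreal_def less_irrefl)
  obtain w where w: "w \<in> B" "g w < (INF w\<in>B. g w) + ennreal (e / 2)"
    using INF_approx_ennreal[of "e / 2" _ g B, OF _ refl] fin e
    by (metis ennreal_add_eq_top half_gt_zero infinity_ennreal_def less_irrefl)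
  have "a \<le> f v + g w" using v w le by blast
  also have "\<dots> \<le> ((INF v\<in>A. f v) + ennreal (e / 2)) + ((INF w\<in>B. g w) + ennreal (e / 2))"
    using v w by (intro add_mono) auto
  also have "\<dots> = (INF v\<in>A. f v) + (INF w\<in>B. g w) + (ennreal (e / 2) + ennreal (e / 2))"
    by (simp add: ac_simps)
  also have "ennreal (e / 2) + ennreal (e / 2) = ennreal e"
    using e by (simp flip: ennreal_plus)
  finally show "a \<le> (INF v\<in>A. f v) + (INF w\<in>B. g w) + ennreal e" .
qed

lemma (in enls) enls_quot_enls:
  assumes Y: "submodule Y cring_class_ops X" and cl: "closedin (enls_topology X) Y"
  shows "enls (quot_enls X Y)"
proof -
  let ?Q = "quot_enls X Y"
  note Q = quot_enls_simps[OF Y]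
  note N = enorm_quot_enls[OF Y]
  have sub: "Y \<subseteq> carrier X" "\<zero> \<in> Y" "\<And>a b. \<lbrakk>a \<in> Y; b \<in> Y\<rbrakk> \<Longrightarrow> a \<oplus> b \<in> Y"
    "\<And>c a. a \<in> Y \<Longrightarrow> c \<odot> a \<in> Y"
    using submoduleE[OF Y] subgroup.one_closed[OF submodule.axioms(1)[OF Y]]
    by (auto simp: carrier_class)
  have Yc: "y \<in> carrier X" if "y \<in> Y" for y using that sub by blast
  have coset0: "Y +> x = Y" if "x \<in> Y" for x
  proof -
    interpret S: abelian_subgroup Y X
      by (rule abelian_subgroupI3[OF _ M.abelian_group_axioms])
        (simp add: additive_subgroup.intro submodule.axioms(1)[OF Y])
    show ?thesis using that by (rule S.a_rcos_const)
  qed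
  have group: "abelian_group ?Q"
  proof (rule abelian_groupI)
    fix C assume "C \<in> carrier ?Q"
    then obtain x where x: "x \<in> carrier X" "C = Y +> x" by (auto simp: Q)
    then have "Y +> (\<ominus> x) \<in> carrier ?Q" "(Y +> (\<ominus> x)) \<oplus>\<^bsub>?Q\<^esub> C = \<zero>\<^bsub>?Q\<^esub>"
      by (auto simp: Q M.l_neg)
    then show "\<exists>D\<in>carrier ?Q. D \<oplus>\<^bsub>?Q\<^esub> C = \<zero>\<^bsub>?Q\<^esub>" by blast
  qed (auto simp: Q M.a_ac)
  have "module cring_class_ops ?Q"
    using R.is_cring group
  proof (rule moduleI)
    fix a b C assume "C \<in> carrier ?Q"
    then obtain x where x: "x \<in> carrier X" "C = Y +> x" by (auto simp: Q)
    show "a \<odot>\<^bsub>?Q\<^esub> C \<in> carrier ?Q" using x by (auto simp: Q carrier_class)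
    show "(a \<oplus>\<^bsub>cring_class_ops\<^esub> b) \<odot>\<^bsub>?Q\<^esub> C = a \<odot>\<^bsub>?Q\<^esub> C \<oplus>\<^bsub>?Q\<^esub> b \<odot>\<^bsub>?Q\<^esub> C"
      using x by (simp add: Q smult_l_distr carrier_class)
    show "(a \<otimes>\<^bsub>cring_class_ops\<^esub> b) \<odot>\<^bsub>?Q\<^esub> C = a \<odot>\<^bsub>?Q\<^esub> (b \<odot>\<^bsub>?Q\<^esub> C)"
      using x by (simp add: Q smult_assoc1 carrier_class)
    show "\<one>\<^bsub>cring_class_ops\<^esub> \<odot>\<^bsub>?Q\<^esub> C = C"
      using x by (simp add: Q)
    fix D assume "D \<in> carrier ?Q"
    then obtain y where y: "y \<in> carrier X" "D = Y +> y" by (auto simp: Q)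
    show "a \<odot>\<^bsub>?Q\<^esub> (C \<oplus>\<^bsub>?Q\<^esub> D) = a \<odot>\<^bsub>?Q\<^esub> C \<oplus>\<^bsub>?Q\<^esub> a \<odot>\<^bsub>?Q\<^esub> D"
      using x y by (simp add: Q smult_r_distr carrier_class)
  qed
  moreover have "enls_axioms ?Q"
  proof
    fix C and c :: 'k assume "C \<in> carrier ?Q"
    then obtain x where x: "x \<in> carrier X" "C = Y +> x" by (auto simp: Q)
    show "enorm ?Q (c \<odot>\<^bsub>?Q\<^esub> C) = ennreal (norm c) * enorm ?Q C"
    proof (cases "c = 0")
      case True
      have "c \<odot> x = \<zero>" using True x smult_l_null[of x] by (simp add: zero_class)
      then have "enorm ?Q (c \<odot>\<^bsub>?Q\<^esub> C) = (INF y\<in>Y. enorm X (\<zero> \<ominus> y))"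
        using x by (simp add: Q N)
      also have "\<dots> \<le> enorm X (\<zero> \<ominus> \<zero>)" by (rule INF_lower) (rule sub)
      finally show ?thesis using True enorm_minus[of \<zero>] by (simp add: enorm_zero a_minus_def)
    next
      case False
      have "Y = (\<lambda>y. c \<odot> y) ` Y"
      proof
        show "Y \<subseteq> (\<lambda>y. c \<odot> y) ` Y"
        proof
          fix y assume y: "y \<in> Y"
          have "c \<odot> (inverse c \<odot> y) = y"
            using False y Yc smult_assoc1[of c "inverse c" y] smult_one[of y]
            by (simp add: carrier_class times_class one_class)
          then show "y \<in> (\<lambda>y. c \<odot> y) ` Y" using sub(4)[OF y, of "inverse c"] by force
        qed
      qed (use sub in auto)
      then have "(INF y\<in>Y. enorm X (c \<odot> x \<ominus> y)) = (INF y\<in>(\<lambda>y. c \<odot> y) ` Y. enorm X (c \<odot> x \<ominus> y))"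
        by simp
      also have "\<dots> = (INF y\<in>Y. ennreal (norm c) * enorm X (x \<ominus> y))"
        unfolding image_image
      proof (rule INF_cong[OF refl])
        fix y assume "y \<in> Y"
        then have "c \<odot> x \<ominus> c \<odot> y = c \<odot> (x \<ominus> y)"
          using x Yc by (simp add: a_minus_def smult_r_distr smult_r_minus carrier_class)
        then show "enorm X (c \<odot> x \<ominus> c \<odot> y) = ennreal (norm c) * enorm X (x \<ominus> y)"
          using enorm_smult[of "x \<ominus> y" c] x Yc \<open>y \<in> Y\<close> by simp
      qed
      also have "\<dots> = ennreal (norm c) * (INF y\<in>Y. enorm X (x \<ominus> y))"
        using False by (intro INF_mult_ennreal) simp
      finally show ?thesis using x by (simp add: Q N carrier_class)
    qed
    show "C = \<zero>\<^bsub>?Q\<^esub>" if "enorm ?Q C = 0"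
    proof -
      have 0: "(INF y\<in>Y. enorm X (x \<ominus> y)) = 0" using that x by (simp add: N)
      have "x \<in> Y"
      proof (rule ccontr)
        assume "x \<notin> Y"
        moreover have "openin (enls_topology X) (carrier X - Y)"
          using cl by (simp add: closedin_def topspace_enls_topology)
        ultimately obtain r where r: "r > 0"
          "\<forall>y\<in>carrier X. enorm X (x \<ominus> y) < ennreal r \<longrightarrow> y \<in> carrier X - Y"
          using x unfolding openin_enls_topology by blast
        have "(INF y\<in>Y. enorm X (x \<ominus> y)) < ennreal r" using r 0 by simp
        then show False using r(2) Yc unfolding INF_less_iff by blast
      qed
      then show ?thesis using x coset0 sub(2) by (simp add: Q)
    qed
    fix D assume "D \<in> carrier ?Q"
    then obtain y where y: "y \<in> carrier X" "D = Y +> y" by (auto simp: Q)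
    have "(INF u\<in>Y. enorm X (x \<oplus> y \<ominus> u)) \<le> enorm X (x \<ominus> v) + enorm X (y \<ominus> w)"
      if "v \<in> Y" "w \<in> Y" for v w
    proof -
      have "(INF u\<in>Y. enorm X (x \<oplus> y \<ominus> u)) \<le> enorm X (x \<oplus> y \<ominus> (v \<oplus> w))"
        by (rule INF_lower) (simp add: sub that)
      also have "x \<oplus> y \<ominus> (v \<oplus> w) = (x \<ominus> v) \<oplus> (y \<ominus> w)"
        using x y that Yc by (simp add: a_minus_def M.minus_add M.a_ac)
      also have "enorm X \<dots> \<le> enorm X (x \<ominus> v) + enorm X (y \<ominus> w)"
        using x y that Yc by (intro enorm_triangle) auto
      finally show ?thesis .
    qed
    then have "(INF u\<in>Y. enorm X (x \<oplus> y \<ominus> u)) \<le>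
        (INF v\<in>Y. enorm X (x \<ominus> v)) + (INF w\<in>Y. enorm X (y \<ominus> w))"
      by (rule le_INF_add_ennreal)
    then show "enorm ?Q (C \<oplus>\<^bsub>?Q\<^esub> D) \<le> enorm ?Q C + enorm ?Q D"
      using x y by (simp add: Q N)
  qed
  ultimately show ?thesis by (rule enls.intro)
qed

end

theory Submission
  imports Defs
begin

text \<open>
  A bounded set of an enls \<open>X\<close> lies in \<open>F + r B\<close> with \<open>F\<close> finite and \<open>B\<close> the unit ball, so a functional
  on \<open>X\<^sup>*\<close> is continuous for \<open>\<tau>\<^sub>u\<^sub>c\<^sub>b\<close> iff it is dominated by a multiple of the dual norm plus finitely
  many evaluation seminorms.  By Hahn-Banach such a functional is the evaluation at a point plus
  a functional dominated by the dual norm alone.  Since the canonical map is always continuous,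
  \<open>X\<close> is reflexive iff every linear functional on \<open>X\<^sup>*\<close> dominated by a multiple of the dual norm is
  an evaluation.  For this property the classical argument for the three-space theorem works,
  identifying \<open>(X/Y)\<^sup>*\<close> with the annihilator of \<open>Y\<close> and extending functionals from \<open>Y\<close>
  without increasing the dual norm.
\<close>

section \<open>The Hahn-Banach theorem for extended seminorms\<close>

text \<open>The obstacle is that \<open>enorm\<close> may be infinite. A point of infinite norm lies
  in no multiple of the unit ball, and the dual norm is only a seminorm on the dual: it sees nothing
  outside the subspace of finite-norm vectors. Evaluation at a point of infinite norm is continuous
  for \<open>ucb_topology\<close>, yet no multiple of the dual norm dominates it. This is why
  evaluation seminorms accompany the dual norm throughout, and why Hahn-Banach is needed for
  dominating functions with infinite values, where an infinite value imposes no constraint. The same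
  obstacle shapes the hard direction of the three-space theorem. There the restriction of the
  functional to the annihilator of \<open>Y\<close> is represented by a coset. Subtracting the
  evaluation at a representative keeps the functional dominated by the dual norm only if the
  representative has finite norm. A coset of infinite quotient norm is excluded because functionals
  of dual norm at most 1 take arbitrarily large values on it, so a representative of finite norm can
  be chosen.\<close>

locale vector_space_record = module "cring_class_ops :: 'k ring" V
  for V :: "('k::real_normed_field, 'a, 'm) module_scheme" (structure)
begin

lemma smult_mem [simp, intro]: "x \<in> carrier V \<Longrightarrow> c \<odot> x \<in> carrier V"
  by (simp add: carrier_class)

lemma smult_add_left: "x \<in> carrier V \<Longrightarrow> (a + b) \<odot> x = a \<odot> x \<oplus> b \<odot> x"
  using smult_l_distr[of a b x] by (simp add: carrier_class plus_class)

lemma smult_add_right: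
  "\<lbrakk>x \<in> carrier V; y \<in> carrier V\<rbrakk> \<Longrightarrow> c \<odot> (x \<oplus> y) = c \<odot> x \<oplus> c \<odot> y"
  using smult_r_distr[of c x y] by (simp add: carrier_class)

lemma smult_smult: "x \<in> carrier V \<Longrightarrow> a \<odot> (b \<odot> x) = (a * b) \<odot> x"
  using smult_assoc1[of a b x] by (simp add: carrier_class times_class)

lemma smult_1: "x \<in> carrier V \<Longrightarrow> 1 \<odot> x = x"
  using smult_one[of x] by (simp add: one_class)

lemma smult_0: "x \<in> carrier V \<Longrightarrow> 0 \<odot> x = \<zero>"
  using smult_l_null[of x] by (simp add: zero_class)

lemma smult_zero: "c \<odot> \<zero> = \<zero>"
  using smult_r_null[of c] by (simp add: carrier_class)

lemma minus_eq_smult: "x \<in> carrier V \<Longrightarrow> \<ominus> x = (- 1) \<odot> x"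
  using smult_l_minus[of 1 x] by (simp add: carrier_class uminus_class smult_1)

lemma diff_eq_smult: "\<lbrakk>x \<in> carrier V; y \<in> carrier V\<rbrakk> \<Longrightarrow> x \<ominus> y = x \<oplus> (- 1) \<odot> y"
  by (simp add: a_minus_def minus_eq_smult)

lemma subspaceI:
  assumes "M \<subseteq> carrier V" "\<zero> \<in> M" "\<And>x y. \<lbrakk>x \<in> M; y \<in> M\<rbrakk> \<Longrightarrow> x \<oplus> y \<in> M"
    and c: "\<And>c x. x \<in> M \<Longrightarrow> c \<odot> x \<in> M"
  shows "submodule M cring_class_ops V"
  using assms c[of _ "- 1"] by (intro submoduleI) (auto simp: minus_eq_smult subset_iff)

lemma subspaceD:
  assumes "submodule M cring_class_ops V"
  shows "M \<subseteq> carrier V" "\<zero> \<in> M" "\<And>x y. \<lbrakk>x \<in> M; y \<in> M\<rbrakk> \<Longrightarrow> x \<oplus> y \<in> M"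
    "\<And>c x. x \<in> M \<Longrightarrow> c \<odot> x \<in> M"
  using submoduleE[OF assms] subgroup.one_closed[OF submodule.axioms(1)[OF assms]]
  by (auto simp: carrier_class)

lemma subspace_span_singleton:
  assumes "x \<in> carrier V"
  shows "submodule (range (\<lambda>c. c \<odot> x)) cring_class_ops V"
proof (rule subspaceI)
  show "\<zero> \<in> range (\<lambda>c. c \<odot> x)"
    using smult_0[OF assms] by (metis rangeI)
  show "u \<oplus> v \<in> range (\<lambda>c. c \<odot> x)"
    if uv: "u \<in> range (\<lambda>c. c \<odot> x)" "v \<in> range (\<lambda>c. c \<odot> x)" for u v
  proof -
    obtain a b where "u = a \<odot> x" "v = b \<odot> x" using uv by blast
    then have "u \<oplus> v = (a + b) \<odot> x" using assms by (simp add: smult_add_left)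
    then show ?thesis by blast
  qed
qed (use assms in \<open>auto simp: smult_smult\<close>)

end

section \<open>Linear functionals, extended seminorms and dominated graphs\<close>

lemma linear_functionalD:
  assumes "linear_functional V \<phi>"
  shows "\<phi> \<in> extensional (carrier V)"
    and "\<lbrakk>x \<in> carrier V; y \<in> carrier V\<rbrakk> \<Longrightarrow> \<phi> (x \<oplus>\<^bsub>V\<^esub> y) = \<phi> x + \<phi> y"
    and "x \<in> carrier V \<Longrightarrow> \<phi> (c \<odot>\<^bsub>V\<^esub> x) = c * \<phi> x"
  using assms by (auto simp: linear_functional_def)

context vector_space_record
begin

lemma linear_functional_zero: "linear_functional V \<phi> \<Longrightarrow> \<phi> \<zero> = 0"
  using linear_functionalD(3)[of V \<phi> \<zero> 0] by (simp add: smult_zero)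

lemma linear_functional_diff:
  "\<lbrakk>linear_functional V \<phi>; x \<in> carrier V; y \<in> carrier V\<rbrakk> \<Longrightarrow> \<phi> (x \<ominus> y) = \<phi> x - \<phi> y"
  by (simp add: diff_eq_smult linear_functionalD)

lemma linear_functional_restrict:
  assumes "\<And>x y. \<lbrakk>x \<in> carrier V; y \<in> carrier V\<rbrakk> \<Longrightarrow> f (x \<oplus> y) = f x + f y"
    and "\<And>c x. x \<in> carrier V \<Longrightarrow> f (c \<odot> x) = c * f x"
  shows "linear_functional V (restrict f (carrier V))"
  using assms by (simp add: linear_functional_def)

lemma linear_functional_comb:
  assumes "linear_functional V f" "linear_functional V g"
  shows "linear_functional V (\<lambda>x\<in>carrier V. f x + c * g x)"
  using assms by (intro linear_functional_restrict) (simp_all add: linear_functionalD algebra_simps)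

end

text \<open>Infinite values are allowed. Homogeneity with scalar 0 and the convention
  \<open>0 * \<infinity> = 0\<close> yield \<open>p \<zero> = 0\<close>.\<close>

definition extended_seminorm ::
    "('k::real_normed_field, 'a, 'm) module_scheme \<Rightarrow> ('a \<Rightarrow> ennreal) \<Rightarrow> bool" where
  "extended_seminorm V p \<longleftrightarrow>
     (\<forall>x\<in>carrier V. \<forall>y\<in>carrier V. p (x \<oplus>\<^bsub>V\<^esub> y) \<le> p x + p y) \<and>
     (\<forall>c. \<forall>x\<in>carrier V. p (c \<odot>\<^bsub>V\<^esub> x) = ennreal (norm c) * p x)"

lemma extended_seminormD:
  assumes "extended_seminorm V p"
  shows "\<lbrakk>x \<in> carrier V; y \<in> carrier V\<rbrakk> \<Longrightarrow> p (x \<oplus>\<^bsub>V\<^esub> y) \<le> p x + p y"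
    and "x \<in> carrier V \<Longrightarrow> p (c \<odot>\<^bsub>V\<^esub> x) = ennreal (norm c) * p x"
  using assms by (auto simp: extended_seminorm_def)

text \<open>The supremum of the lower bounds works; an empty index set is treated apart because it
  has no useful real supremum. The lemma supplies the value of an extension at a new vector.\<close>

lemma exists_between_reals:
  fixes l u :: "'i \<Rightarrow> real"
  assumes "\<And>i j. \<lbrakk>i \<in> S; j \<in> S\<rbrakk> \<Longrightarrow> l i \<le> u j"
  shows "\<exists>a. \<forall>i\<in>S. l i \<le> a \<and> a \<le> u i"
proof (cases "S = {}")
  case False
  then obtain j where j: "j \<in> S" by blast
  have bdd: "bdd_above (l ` S)" using assms j by (auto intro!: bdd_aboveI2)
  have "l i \<le> (SUP i\<in>S. l i) \<and> (SUP i\<in>S. l i) \<le> u i" if "i \<in> S" for i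
    using that assms bdd j by (auto intro: cSUP_upper cSUP_least)
  then show ?thesis by blast
qed auto

text \<open>
  Single-valuedness need not be demanded: \<open>(\<zero>, a)\<close> in the graph forces \<open>\<bar>a\<bar> \<le> p \<zero> = 0\<close>.
\<close>

definition dominated_graph ::
    "('k::real_normed_field, 'a, 'm) module_scheme \<Rightarrow> ('a \<Rightarrow> ennreal) \<Rightarrow> ('a \<times> real) set \<Rightarrow> bool" where
  "dominated_graph V p G \<longleftrightarrow>
     G \<subseteq> carrier V \<times> UNIV \<and>
     (\<forall>x a y b. (x, a) \<in> G \<longrightarrow> (y, b) \<in> G \<longrightarrow> (x \<oplus>\<^bsub>V\<^esub> y, a + b) \<in> G) \<and>
     (\<forall>r x a. (x, a) \<in> G \<longrightarrow> (of_real r \<odot>\<^bsub>V\<^esub> x, r * a) \<in> G) \<and>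
     (\<forall>x a. (x, a) \<in> G \<longrightarrow> ennreal \<bar>a\<bar> \<le> p x)"

lemma dominated_graphD:
  assumes "dominated_graph V p G"
  shows "(x, a) \<in> G \<Longrightarrow> x \<in> carrier V"
    and "\<lbrakk>(x, a) \<in> G; (y, b) \<in> G\<rbrakk> \<Longrightarrow> (x \<oplus>\<^bsub>V\<^esub> y, a + b) \<in> G"
    and "(x, a) \<in> G \<Longrightarrow> (of_real r \<odot>\<^bsub>V\<^esub> x, r * a) \<in> G"
    and "(x, a) \<in> G \<Longrightarrow> ennreal \<bar>a\<bar> \<le> p x"
  using assms by (auto simp: dominated_graph_def)

context vector_space_record
begin

lemma dominated_graph_unique:
  assumes p: "extended_seminorm V p" and G: "dominated_graph V p G"
    and "(x, a) \<in> G" "(x, b) \<in> G"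
  shows "a = b"
proof -
  have x: "x \<in> carrier V" using dominated_graphD(1)[OF G] assms by blast
  have "(of_real (-1) \<odot> x, - 1 * b) \<in> G" using dominated_graphD(3)[OF G] assms by blast
  then have "(x \<oplus> (- 1) \<odot> x, a - b) \<in> G"
    using dominated_graphD(2)[OF G \<open>(x, a) \<in> G\<close>] by fastforce
  moreover have "x \<oplus> (- 1) \<odot> x = \<zero>"
    using x by (simp add: minus_eq_smult[symmetric] M.r_neg)
  ultimately have "ennreal \<bar>a - b\<bar> \<le> p \<zero>" using dominated_graphD(4)[OF G] by metis
  also have "p \<zero> = 0"
    using extended_seminormD(2)[OF p, of \<zero> 0] by (simp add: smult_zero)
  finally show ?thesis by simp
qed

text \<open>The one-vector step of Hahn-Banach: a value \<open>a\<close> at \<open>x\<close> must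
  satisfy \<open>\<bar>b + a\<bar> \<le> p (u \<oplus> x)\<close> for all \<open>(u, b)\<close> in
  \<open>G\<close>, and homogeneity reduces every other multiple of \<open>x\<close> to this case.
  If \<open>x\<close> already lies in the domain, the pair of \<open>\<ominus> x\<close> forces the
  old value.\<close>

lemma dominated_graph_extend:
  assumes p: "extended_seminorm V p" and G: "dominated_graph V p G"
    and ne: "G \<noteq> {}" and x: "x \<in> carrier V"
  shows "\<exists>G'. dominated_graph V p G' \<and> G \<subseteq> G' \<and> x \<in> fst ` G'"
proof -
  note GD = dominated_graphD[OF G]
  \<comment> \<open>Where \<open>p (u \<oplus> x)\<close> is infinite the inequality for
    \<open>a\<close> is void, so only the finite values have to be met, and these can be handled as
    reals.\<close>
  let ?S = "{(u, b). (u, b) \<in> G \<and> p (u \<oplus> x) < \<infinity>}"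
  let ?q = "\<lambda>u. enn2real (p (u \<oplus> x))"
  \<comment> \<open>Compatibility of the lower and upper bounds comes from
    \<open>v - u = (v + x) - (u + x)\<close> and the triangle inequality.\<close>
  have between: "- ?q u - b \<le> ?q v - c" if "(u, b) \<in> ?S" "(v, c) \<in> ?S" for u b v c
  proof -
    have uv: "(u, b) \<in> G" "(v, c) \<in> G" "p (u \<oplus> x) < \<infinity>" "p (v \<oplus> x) < \<infinity>"
      using that by auto
    then have car: "u \<in> carrier V" "v \<in> carrier V" using GD(1) by blast+
    have "(v \<oplus> of_real (- 1) \<odot> u, c + (- 1) * b) \<in> G" by (intro GD(2,3) uv)
    then have "ennreal \<bar>c - b\<bar> \<le> p (v \<oplus> (- 1) \<odot> u)" using GD(4) by fastforce
    also have "v \<oplus> (- 1) \<odot> u = (v \<oplus> x) \<oplus> (- 1) \<odot> (u \<oplus> x)"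
      using car x proof -
      have "x \<oplus> (\<ominus> u \<oplus> \<ominus> x) = \<ominus> u"
        using car x by (metis M.a_lcomm M.add.inv_closed M.r_neg M.r_zero)
      then show ?thesis using car x by (simp add: minus_eq_smult[symmetric] M.minus_add M.a_assoc)
    qed
    also have "p \<dots> \<le> p (v \<oplus> x) + p ((- 1) \<odot> (u \<oplus> x))"
      using car x by (intro extended_seminormD[OF p]) auto
    also have "\<dots> = p (v \<oplus> x) + p (u \<oplus> x)"
      using car x by (simp add: extended_seminormD(2)[OF p])
    also have "\<dots> = ennreal (?q v + ?q u)" using uv by simp
    finally have "\<bar>c - b\<bar> \<le> ?q v + ?q u" by (simp del: ennreal_plus)
    then show ?thesis by linarith
  qed
  obtain a where a: "\<And>u b. (u, b) \<in> ?S \<Longrightarrow> - ?q u - b \<le> a \<and> a \<le> ?q u - b"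
    using exists_between_reals[of ?S "\<lambda>(u, b). - ?q u - b" "\<lambda>(u, b). ?q u - b"] between
    by (auto simp: split_paired_all) 
  have a': "ennreal \<bar>b + a\<bar> \<le> p (u \<oplus> x)" if "(u, b) \<in> G" for u b
  proof (cases "p (u \<oplus> x) < \<infinity>")
    case True
    then have "\<bar>b + a\<bar> \<le> ?q u" using a[of u b] that by auto
    then have "ennreal \<bar>b + a\<bar> \<le> ennreal (?q u)" by (rule ennreal_leI)
    also have "ennreal (?q u) = p (u \<oplus> x)" using True by simp
    finally show ?thesis .
  next
    case False then show ?thesis by (simp add: top.not_eq_extremum[symmetric])
  qed
  let ?G = "{(u \<oplus> of_real r \<odot> x, b + r * a) | u b r. (u, b) \<in> G}"
  have "dominated_graph V p ?G"
    unfolding dominated_graph_def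
  proof (intro conjI allI impI)
    show "?G \<subseteq> carrier V \<times> UNIV" using GD(1) x by auto
    fix y b assume "(y, b) \<in> ?G"
    then obtain u c r where y: "(u, c) \<in> G" "y = u \<oplus> of_real r \<odot> x" "b = c + r * a" by blast
    have u: "u \<in> carrier V" using y GD(1) by blast
    show "(of_real s \<odot> y, s * b) \<in> ?G" for s
    proof -
      have "of_real s \<odot> y = of_real s \<odot> u \<oplus> of_real (s * r) \<odot> x" "s * b = s * c + (s * r) * a"
        using y u x by (simp_all add: smult_add_right smult_smult algebra_simps)
      then show ?thesis using GD(3)[OF y(1), of s] by blast
    qed
    show "(y \<oplus> z, b + d) \<in> ?G" if zd: "(z, d) \<in> ?G" for z d
    proof -
      obtain v e s where z: "(v, e) \<in> G" "z = v \<oplus> of_real s \<odot> x" "d = e + s * a"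
        using zd by blast
      have v: "v \<in> carrier V" using z GD(1) by blast
      have "y \<oplus> z = (u \<oplus> v) \<oplus> of_real (r + s) \<odot> x" "b + d = (c + e) + (r + s) * a"
        using y z u v x by (simp_all add: smult_add_left M.a_ac algebra_simps)
      then show ?thesis using GD(2)[OF y(1) z(1)] by blast
    qed
    show "ennreal \<bar>b\<bar> \<le> p y"
    proof (cases "r = 0")
      case True then show ?thesis using y u x GD(4) by (simp add: smult_0)
    next
      case False
      \<comment> \<open>Dividing by \<open>r\<close> brings the coefficient of \<open>x\<close> to
        1, where \<open>a'\<close> applies; multiplying back uses homogeneity of
        \<open>p\<close>.\<close>
      have "(of_real (1 / r) \<odot> u, 1 / r * c) \<in> G" by (rule GD(3)) (rule y)
      then have "ennreal \<bar>1 / r * c + a\<bar> \<le> p (of_real (1 / r) \<odot> u \<oplus> x)" by (rule a')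
      then have "ennreal \<bar>r\<bar> * ennreal \<bar>1 / r * c + a\<bar>
          \<le> ennreal (norm (of_real r :: 'k)) * p (of_real (1 / r) \<odot> u \<oplus> x)"
        by (simp add: mult_left_mono)
      also have "\<dots> = p (of_real r \<odot> (of_real (1 / r) \<odot> u \<oplus> x))"
        using u x by (simp add: extended_seminormD(2)[OF p])
      also have "of_real r \<odot> (of_real (1 / r) \<odot> u \<oplus> x) = y"
        using y u x False by (simp add: smult_add_right smult_smult smult_1)
      also have "ennreal \<bar>r\<bar> * ennreal \<bar>1 / r * c + a\<bar> = ennreal \<bar>b\<bar>"
        using y False by (simp add: ennreal_mult[symmetric] abs_mult[symmetric] algebra_simps)
      finally show ?thesis .
    qed
  qed
  moreover have "G \<subseteq> ?G"
  proof (rule subrelI)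
    fix u b assume ub: "(u, b) \<in> G"
    then have "(u \<oplus> of_real 0 \<odot> x, b + 0 * a) \<in> ?G" by blast
    then show "(u, b) \<in> ?G" using GD(1)[OF ub] x by (simp add: smult_0)
  qed
  moreover have "x \<in> fst ` ?G"
  proof -
    obtain u b where ub: "(u, b) \<in> G" using ne by auto
    then have "(of_real 0 \<odot> u, 0 * b) \<in> G" by (rule GD(3))
    then have "(\<zero>, 0) \<in> G" using GD(1)[OF ub] by (simp add: smult_0)
    then have "(\<zero> \<oplus> of_real 1 \<odot> x, 0 + 1 * a) \<in> ?G" by blast
    then show ?thesis using x by (force simp: smult_1)
  qed
  ultimately show ?thesis by blast
qed

text \<open>Zorn's lemma for inclusion: a maximal dominated graph has full domain, since any missing
  vector could be adjoined. Graphs are linear over the reals only, so this is real Hahn-Banach also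
  for complex scalars.\<close>

lemma dominated_graph_total_extension:
  assumes p: "extended_seminorm V p" and G0: "dominated_graph V p G0" "G0 \<noteq> {}"
  shows "\<exists>G. dominated_graph V p G \<and> G0 \<subseteq> G \<and> fst ` G = carrier V"
proof -
  let ?A = "{G. dominated_graph V p G \<and> G0 \<subseteq> G}"
  have "\<exists>M\<in>?A. \<forall>X\<in>?A. M \<subseteq> X \<longrightarrow> X = M"
  proof (rule subset_Zorn_nonempty)
    show "?A \<noteq> {}" using G0 by blast
    fix C assume C: "C \<noteq> {}" "subset.chain ?A C"
    then have dg: "dominated_graph V p G" if "G \<in> C" for G
      using that by (auto simp: subset_chain_def)
    have two: "\<exists>G\<in>C. q \<in> G \<and> q' \<in> G" if "q \<in> \<Union>C" "q' \<in> \<Union>C" for q q'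
      using that C(2) unfolding subset_chain_def by blast
    have "dominated_graph V p (\<Union>C)"
      unfolding dominated_graph_def
    proof (intro conjI allI impI)
      show "\<Union>C \<subseteq> carrier V \<times> UNIV" using dominated_graphD(1)[OF dg] by fastforce
      fix x a assume xa: "(x, a) \<in> \<Union>C"
      show "(of_real r \<odot> x, r * a) \<in> \<Union>C" for r using xa dominated_graphD(3)[OF dg] by blast
      show "ennreal \<bar>a\<bar> \<le> p x" using xa dominated_graphD(4)[OF dg] by blast
      show "(x \<oplus> y, a + b) \<in> \<Union>C" if "(y, b) \<in> \<Union>C" for y b
        using two[OF xa that] dominated_graphD(2)[OF dg] by blast
    qed
    moreover have "G0 \<subseteq> \<Union>C" using C unfolding subset_chain_def by blast
    ultimately show "\<Union>C \<in> ?A" by blast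
  qed
  then obtain G where G: "dominated_graph V p G" "G0 \<subseteq> G"
    and max: "\<And>G'. \<lbrakk>dominated_graph V p G'; G \<subseteq> G'\<rbrakk> \<Longrightarrow> G' = G"
    by (smt (verit) dual_order.trans mem_Collect_eq)
  have "G \<noteq> {}" using G G0 by blast
  then have "carrier V \<subseteq> fst ` G"
    using dominated_graph_extend[OF p G(1)] max by blast
  moreover have "fst ` G \<subseteq> carrier V" using dominated_graphD(1)[OF G(1)] by auto
  ultimately show ?thesis using G by blast
qed

end

text \<open>
  The properties of the real part that reduce complex Hahn-Banach to the real case: a
  \<open>'k\<close>-linear functional \<open>f\<close> and the real-linear functional \<open>re \<circ> f\<close> determine each other.
\<close>

locale scalar_real_part =
  fixes re :: "'k::real_normed_field \<Rightarrow> real"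
  assumes re_add: "re (a + b) = re a + re b"
    and re_of_real_mult: "re (of_real r * a) = r * re a"
    and abs_re_le: "\<bar>re a\<bar> \<le> norm a"
    and re_rotate: "\<exists>c. norm c = 1 \<and> re (c * a) = norm a"
    and re_represent: "\<lbrakk>\<And>a b. h (a + b) = h a + h b; \<And>r a. h (of_real r * a) = r * h a\<rbrakk>
      \<Longrightarrow> \<exists>b. \<forall>c. h c = re (c * b)"
begin

lemma re_diff: "re (a - b) = re a - re b"
  using re_add[of "a - b" b] by simp

lemma eq_if_re_eq:
  assumes "\<And>c. re (c * a) = re (c * b)" shows "a = b"
proof -
  obtain c where c: "re (c * (a - b)) = norm (a - b)" using re_rotate[of "a - b"] by blast
  then have "norm (a - b) = 0" using assms[of c] by (simp add: right_diff_distrib re_diff)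
  then show ?thesis by simp
qed

text \<open>Extend \<open>re \<circ> f\<close> as a real-linear functional \<open>U\<close> and
  recover \<open>g\<close> from \<open>U (c \<odot> x) = re (c * g x)\<close>. Since a scalar is
  determined by the real parts of its multiples, \<open>g\<close> inherits linearity over the full
  field and the agreement with \<open>f\<close> on \<open>M\<close>.\<close>

theorem hahn_banach:
  fixes V :: "('k, 'a, 'm) module_scheme" (structure) and f :: "'a \<Rightarrow> 'k"
  assumes V: "vector_space_record V" and M: "submodule M cring_class_ops V"
    and p: "extended_seminorm V p"
    and f_add: "\<And>x y. \<lbrakk>x \<in> M; y \<in> M\<rbrakk> \<Longrightarrow> f (x \<oplus>\<^bsub>V\<^esub> y) = f x + f y"
    and f_smult: "\<And>c x. x \<in> M \<Longrightarrow> f (c \<odot>\<^bsub>V\<^esub> x) = c * f x"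
    and f_le: "\<And>x. x \<in> M \<Longrightarrow> ennreal (norm (f x)) \<le> p x"
  shows "\<exists>g. linear_functional V g \<and> (\<forall>x\<in>M. g x = f x) \<and>
    (\<forall>x\<in>carrier V. ennreal (norm (g x)) \<le> p x)"
proof -
  interpret vector_space_record V by (rule V)
  note MD = subspaceD[OF M]
  let ?G0 = "(\<lambda>x. (x, re (f x))) ` M"
  have "dominated_graph V p ?G0"
    unfolding dominated_graph_def
  proof (intro conjI allI impI)
    fix x and a :: real assume "(x, a) \<in> ?G0"
    then have x: "x \<in> M" "a = re (f x)" by auto
    then have "ennreal \<bar>a\<bar> \<le> ennreal (norm (f x))" by (simp add: abs_re_le)
    then show "ennreal \<bar>a\<bar> \<le> p x" using f_le x by (meson order_trans)
  qed (use MD in \<open>auto simp: f_add f_smult re_add re_of_real_mult\<close>)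
  moreover have "?G0 \<noteq> {}" using MD by blast
  ultimately obtain G where G: "dominated_graph V p G" "?G0 \<subseteq> G" "fst ` G = carrier V"
    using dominated_graph_total_extension[OF p] by blast
  note GD = dominated_graphD[OF G(1)] and unique = dominated_graph_unique[OF p G(1)]
  have "\<forall>x\<in>carrier V. \<exists>a. (x, a) \<in> G" using G(3) by force
  then obtain U where U: "\<And>x. x \<in> carrier V \<Longrightarrow> (x, U x) \<in> G" by metis
  have U_add: "U (x \<oplus> y) = U x + U y" if "x \<in> carrier V" "y \<in> carrier V" for x y
    using that by (blast intro: unique U GD(2))
  have U_smult: "U (of_real r \<odot> x) = r * U x" if "x \<in> carrier V" for r x
    using that by (blast intro: unique U GD(3))
  have U_M: "U x = re (f x)" if "x \<in> M" for x
    using that MD G(2) by (intro unique[of x, OF U]) auto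
  \<comment> \<open>For fixed \<open>x\<close> the map from \<open>c\<close> to
    \<open>U (c \<odot> x)\<close> is a real-linear functional on the scalars, hence represented by
    one scalar, the future \<open>g x\<close>.\<close>
  have "\<exists>b. \<forall>c. U (c \<odot> x) = re (c * b)" if "x \<in> carrier V" for x
    by (rule re_represent) (use that in \<open>simp_all add: smult_add_left U_add U_smult smult_smult[symmetric]\<close>)
  then obtain g where g: "\<And>x c. x \<in> carrier V \<Longrightarrow> U (c \<odot> x) = re (c * g x)" by metis
  have "linear_functional V (restrict g (carrier V))"
  proof (rule linear_functional_restrict)
    show "g (x \<oplus> y) = g x + g y" if "x \<in> carrier V" "y \<in> carrier V" for x y
      using that by (intro eq_if_re_eq)
        (simp add: g[symmetric] smult_add_right U_add distrib_left re_add)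
    show "g (c \<odot> x) = c * g x" if "x \<in> carrier V" for c x
      using that by (intro eq_if_re_eq) (simp add: g[symmetric] smult_smult mult.assoc[symmetric])
  qed
  moreover have "\<forall>x\<in>M. g x = f x"
    using MD by (auto intro!: eq_if_re_eq simp: g[symmetric] U_M f_smult subset_iff)
  moreover have "ennreal (norm (g x)) \<le> p x" if x: "x \<in> carrier V" for x
  proof -
    \<comment> \<open>A scalar of norm 1 turns the bound on the real part into a bound on the
      norm.\<close>
    obtain c where c: "norm c = 1" "re (c * g x) = norm (g x)" using re_rotate by blast
    then have "U (c \<odot> x) = norm (g x)" using g x by simp
    then have "ennreal (norm (g x)) \<le> p (c \<odot> x)" using GD(4)[OF U[of "c \<odot> x"]] x by simp
    then show ?thesis using c x by (simp add: extended_seminormD(2)[OF p])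
  qed
  ultimately show ?thesis using MD by (intro exI[of _ "restrict g (carrier V)"]) auto
qed

end

section \<open>The two scalar fields\<close>

lemma scalar_real_part_real: "scalar_real_part (\<lambda>x::real. x)"
proof (unfold_locales, goal_cases)
  case (4 a)
  show "\<exists>c::real. norm c = 1 \<and> c * a = norm a"
    by (rule exI[of _ "if a < 0 then - 1 else 1"]) simp
next
  case (5 h)
  have "h c = c * h 1" for c using 5(2)[of c 1] by simp
  then show ?case by blast
qed simp_all

lemma scalar_real_part_Re: "scalar_real_part Re"
proof (unfold_locales, goal_cases)
  case (4 a)
  show "\<exists>c. norm c = 1 \<and> Re (c * a) = norm a"
  proof (cases "a = 0")
    case True then show ?thesis by (intro exI[of _ 1]) simp
  next
    case False
    have "cnj (sgn a) * a = norm a"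
      using complex_norm_square[of a] False
      by (simp add: sgn_eq field_simps power2_eq_square)
    with False show ?thesis
      by (intro exI[of _ "cnj (sgn a)"]) (simp add: norm_sgn)
  qed
next
  case (5 h)
  \<comment> \<open>The witness is read off from \<open>h c = Re c * h 1 + Im c * h \<i>\<close>;
    the minus sign compensates for \<open>\<i> * \<i> = - 1\<close>.\<close>
  have "h c = Re (c * Complex (h 1) (- h \<i>))" for c
  proof -
    have "h c = h (of_real (Re c) * 1 + of_real (Im c) * \<i>)"
      by (simp add: complex_eq[symmetric] mult.commute)
    then show ?thesis by (simp only: 5) simp
  qed
  then show "\<exists>b. \<forall>c. h c = Re (c * b)" by blast
qed (simp_all add: abs_Re_le_cmod)

section \<open>The dual of an extended normed space\<close>

sublocale enls \<subseteq> vector_space_record X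
  by unfold_locales

abbreviation dual_space :: "('k::real_normed_field, 'a) enorm_space \<Rightarrow> ('k, 'a \<Rightarrow> 'k) module" where
  "dual_space X \<equiv> dual X (enls_topology X)"

text \<open>The open unit ball is used because the quotient map sends it exactly onto the open unit
  ball of the quotient. A nonzero functional that vanishes on all finite-norm vectors has dual norm
  0. The argument may be any function, so pointwise differences are covered too.\<close>

definition dual_norm :: "('k::real_normed_field, 'a) enorm_space \<Rightarrow> ('a \<Rightarrow> 'k) \<Rightarrow> ennreal" where
  "dual_norm X = sup_seminorm {x \<in> carrier X. enorm X x < 1}"

lemma dual_simps:
  "\<zero>\<^bsub>dual V T\<^esub> = (\<lambda>x\<in>carrier V. 0)"
  "\<phi> \<oplus>\<^bsub>dual V T\<^esub> \<psi> = (\<lambda>x\<in>carrier V. \<phi> x + \<psi> x)"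
  "c \<odot>\<^bsub>dual V T\<^esub> \<phi> = (\<lambda>x\<in>carrier V. c * \<phi> x)"
  by (simp_all add: dual_def)

lemma norm_le_sup_seminorm: "x \<in> B \<Longrightarrow> ennreal (norm (\<phi> x)) \<le> sup_seminorm B \<phi>"
  unfolding sup_seminorm_def by (rule SUP_upper)

lemma sup_seminorm_le:
  "(\<And>x. x \<in> B \<Longrightarrow> ennreal (norm (\<phi> x)) \<le> c) \<Longrightarrow> sup_seminorm B \<phi> \<le> c"
  unfolding sup_seminorm_def by (rule SUP_least)

lemma sup_seminorm_cong:
  "(\<And>x. x \<in> B \<Longrightarrow> \<phi> x = \<psi> x) \<Longrightarrow> sup_seminorm B \<phi> = sup_seminorm B \<psi>"
  unfolding sup_seminorm_def by simp

lemma sup_seminorm_mono: "A \<subseteq> B \<Longrightarrow> sup_seminorm A \<phi> \<le> sup_seminorm B \<phi>"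
  unfolding sup_seminorm_def by (rule SUP_subset_mono) auto

lemma ennreal_norm_triangle:
  fixes a b :: "'k::real_normed_vector"
  shows "ennreal (norm (a + b)) \<le> ennreal (norm a) + ennreal (norm b)"
  by (simp add: norm_triangle_ineq ennreal_leI flip: ennreal_plus)

lemma ennreal_norm_mult:
  fixes a b :: "'k::real_normed_field"
  shows "ennreal (norm (a * b)) = ennreal (norm a) * ennreal (norm b)"
  by (simp add: norm_mult ennreal_mult)

lemma sup_seminorm_add: "sup_seminorm B (\<lambda>x. \<phi> x + \<psi> x) \<le> sup_seminorm B \<phi> + sup_seminorm B \<psi>"
proof (rule sup_seminorm_le)
  fix x assume "x \<in> B"
  then show "ennreal (norm (\<phi> x + \<psi> x)) \<le> sup_seminorm B \<phi> + sup_seminorm B \<psi>"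
    by (intro order_trans[OF ennreal_norm_triangle] add_mono norm_le_sup_seminorm)
qed

lemma sup_seminorm_mult: "sup_seminorm B (\<lambda>x. c * \<phi> x) = ennreal (norm c) * sup_seminorm B \<phi>"
  by (simp add: sup_seminorm_def ennreal_norm_mult SUP_mult_left_ennreal)

lemma extended_seminorm_sup_seminorm:
  fixes V :: "('k::real_normed_field, 'a, 'm) module_scheme"
  assumes "B \<subseteq> carrier V"
  shows "extended_seminorm (dual V T) (sup_seminorm B)"
proof -
  \<comment> \<open>The operations of the dual restrict to the carrier; a supremum over a subset of
    the carrier does not notice this.\<close>
  have "sup_seminorm B (restrict f (carrier V)) = sup_seminorm B f" for f :: "'a \<Rightarrow> 'k"
    using assms by (intro sup_seminorm_cong) auto
  then show ?thesis
    by (simp add: extended_seminorm_def dual_simps sup_seminorm_add sup_seminorm_mult)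
qed

lemma extended_seminorm_add:
  assumes p: "extended_seminorm V p" and q: "extended_seminorm V q"
  shows "extended_seminorm V (\<lambda>x. p x + q x)"
  unfolding extended_seminorm_def
proof (intro conjI ballI allI)
  fix x y assume xy: "x \<in> carrier V" "y \<in> carrier V"
  have "p (x \<oplus>\<^bsub>V\<^esub> y) + q (x \<oplus>\<^bsub>V\<^esub> y) \<le> (p x + p y) + (q x + q y)"
    using xy by (intro add_mono extended_seminormD(1) p q)
  then show "p (x \<oplus>\<^bsub>V\<^esub> y) + q (x \<oplus>\<^bsub>V\<^esub> y) \<le> p x + q x + (p y + q y)" by (simp add: ac_simps)
qed (simp add: extended_seminormD(2)[OF p] extended_seminormD(2)[OF q] distrib_left)

lemma extended_seminorm_mult:
  "extended_seminorm V p \<Longrightarrow> extended_seminorm V (\<lambda>x. c * p x)"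
  by (auto simp: extended_seminorm_def mult.left_commute simp flip: distrib_left intro: mult_left_mono)

context enls
begin

lemma enorm_diff_le:
  "\<lbrakk>x \<in> carrier X; y \<in> carrier X\<rbrakk> \<Longrightarrow> enorm X (x \<ominus> y) \<le> enorm X x + enorm X y"
  using enorm_triangle[of x "\<ominus> y"] by (simp add: a_minus_def enorm_minus)

text \<open>Scale \<open>x\<close> by \<open>1 / s\<close> with \<open>s\<close> above its norm, so
  that it enters the open unit ball, and let \<open>s\<close> decrease to the norm. Finiteness
  matters: with dual norm 0 and \<open>enorm X x = \<infinity>\<close> the right-hand side would be
  0 although \<open>\<phi> x\<close> may be nonzero.\<close>

lemma norm_le_dual_norm:
  assumes \<phi>: "linear_functional X \<phi>" and x: "x \<in> carrier X" and fin: "enorm X x < \<infinity>"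
  shows "ennreal (norm (\<phi> x)) \<le> dual_norm X \<phi> * enorm X x"
proof (cases "enorm X x = 0")
  case True
  then have "x = \<zero>" using x enorm_eq_0D by blast
  then show ?thesis using linear_functional_zero[OF \<phi>] by simp
next
  case False
  obtain t where t: "enorm X x = ennreal t" "0 \<le> t" using fin by (cases "enorm X x") auto
  have "0 < t" using t False by (cases "t = 0") auto
  show ?thesis
  proof (cases "dual_norm X \<phi>")
    case (real d)
    have s: "norm (\<phi> x) \<le> d * s" if "t < s" for s
    proof -
      have "0 < s" using that t by simp
      have "enorm X (of_real (1 / s) \<odot> x) = ennreal (t / s)"
        using x t \<open>0 < s\<close> by (simp add: enorm_smult norm_divide ennreal_mult[symmetric])
      also have "\<dots> < 1" using that \<open>0 < s\<close> by (simp add: ennreal_less_one_iff)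
      finally have "ennreal (norm (\<phi> (of_real (1 / s) \<odot> x))) \<le> dual_norm X \<phi>"
        unfolding dual_norm_def using x by (intro norm_le_sup_seminorm) auto
      then have "norm (\<phi> (of_real (1 / s) \<odot> x)) \<le> d" using real by simp
      then show ?thesis
        using x \<open>0 < s\<close> by (simp add: linear_functionalD(3)[OF \<phi>] norm_mult norm_divide field_simps)
    qed
    have "norm (\<phi> x) \<le> d * t"
    \<comment> \<open>The limit in \<open>s\<close> is taken after division by \<open>d\<close>,
      hence the separate case.\<close>
    proof (cases "d = 0")
      case True then show ?thesis using s[of "t + 1"] by simp
    next
      case False
      then have "0 < d" using real by simp
      have "norm (\<phi> x) / d \<le> t"
      proof (rule dense_ge)
        fix u assume "t < u"
        then show "norm (\<phi> x) / d \<le> u" using s[of u] \<open>0 < d\<close> by (simp add: field_simps)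
      qed
      then show ?thesis using \<open>0 < d\<close> by (simp add: field_simps)
    qed
    then show ?thesis using real t by (simp add: ennreal_mult[symmetric])
  next
    case top
    then show ?thesis using False by (simp add: ennreal_top_mult)
  qed
qed

lemma dual_norm_le:
  assumes "\<And>x. \<lbrakk>x \<in> carrier X; enorm X x < \<infinity>\<rbrakk> \<Longrightarrow> ennreal (norm (\<phi> x)) \<le> c * enorm X x"
  shows "dual_norm X \<phi> \<le> c"
  unfolding dual_norm_def
proof (rule sup_seminorm_le)
  fix x assume "x \<in> {x \<in> carrier X. enorm X x < 1}"
  then have x: "x \<in> carrier X" "enorm X x < 1" by auto
  then have "enorm X x < \<infinity>" by (metis ennreal_one_less_top infinity_ennreal_def order_less_trans)
  then have "ennreal (norm (\<phi> x)) \<le> c * enorm X x" using assms x by blast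
  also have "\<dots> \<le> c * 1" using x by (intro mult_left_mono) auto
  finally show "ennreal (norm (\<phi> x)) \<le> c" by simp
qed

lemma enorm_zero_diff: "y \<in> carrier X \<Longrightarrow> enorm X (\<zero> \<ominus> y) = enorm X y"
  by (simp add: a_minus_def enorm_minus)

text \<open>Continuity at \<open>\<zero>\<close> bounds \<open>\<phi>\<close> on a small ball, and
  scaling carries the bound to the unit ball. Conversely, points that are close to each other differ
  by a vector of finite norm, so \<open>norm_le_dual_norm\<close> gives a local Lipschitz estimate
  even around points of infinite norm.\<close>

lemma mem_dual_iff:
  "\<phi> \<in> carrier (dual_space X) \<longleftrightarrow> linear_functional X \<phi> \<and> dual_norm X \<phi> < \<infinity>"
proof -
  have "dual_norm X \<phi> < \<infinity>"
    if lin: "linear_functional X \<phi>" and cont: "continuous_map (enls_topology X) euclidean \<phi>"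
  proof -
    have "openin (enls_topology X) {x \<in> carrier X. \<phi> x \<in> ball 0 1}"
      using cont openin_continuous_map_preimage[OF cont, of "ball 0 1"]
      by (simp add: topspace_enls_topology)
    moreover have "\<zero> \<in> {x \<in> carrier X. \<phi> x \<in> ball 0 1}"
      using linear_functional_zero[OF lin] by simp
    ultimately obtain r where r: "r > 0"
      "\<forall>y\<in>carrier X. enorm X (\<zero> \<ominus> y) < ennreal r \<longrightarrow> y \<in> {x \<in> carrier X. \<phi> x \<in> ball 0 1}"
      unfolding openin_enls_topology by blast
    have "dual_norm X \<phi> \<le> ennreal (1 / r)"
      unfolding dual_norm_def
    proof (rule sup_seminorm_le)
      fix x assume "x \<in> {x \<in> carrier X. enorm X x < 1}"
      then have x: "x \<in> carrier X" "enorm X x < 1" by auto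
      have "ennreal r * enorm X x < ennreal r * 1"
        using x r by (intro ennreal_mult_strict_left_mono) auto
      then have "enorm X (of_real r \<odot> x) < ennreal r" using x r by (simp add: enorm_smult)
      then have "norm (\<phi> (of_real r \<odot> x)) < 1" using r x by (simp add: enorm_zero_diff)
      then show "ennreal (norm (\<phi> x)) \<le> ennreal (1 / r)"
        using x r by (intro ennreal_leI) (simp add: linear_functionalD(3)[OF lin] norm_mult field_simps)
    qed
    then show ?thesis by (simp add: order_le_less_trans)
  qed
  moreover have "continuous_map (enls_topology X) euclidean \<phi>"
    if lin: "linear_functional X \<phi>" and fin: "dual_norm X \<phi> < \<infinity>"
    unfolding continuous_map_def
  proof (intro conjI allI impI)
    show "\<phi> \<in> topspace (enls_topology X) \<rightarrow> topspace euclidean" by auto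
    fix W :: "'k set" assume "openin euclidean W"
    then have W: "open W" by simp
    obtain d where d: "dual_norm X \<phi> = ennreal d" "0 \<le> d" using fin by (cases "dual_norm X \<phi>") auto
    have "\<exists>r>0. \<forall>y\<in>carrier X. enorm X (x \<ominus> y) < ennreal r \<longrightarrow> \<phi> y \<in> W"
      if x: "x \<in> carrier X" "\<phi> x \<in> W" for x
    proof -
      obtain e where e: "e > 0" "ball (\<phi> x) e \<subseteq> W" using W x open_contains_ball by blast
      \<comment> \<open>The \<open>+ 1\<close> keeps the radius defined for \<open>d = 0\<close> and
        the final estimate strict.\<close>
      have "\<phi> y \<in> W" if y: "y \<in> carrier X" "enorm X (x \<ominus> y) < ennreal (e / (d + 1))" for y
      proof -
        have "enorm X (x \<ominus> y) < \<infinity>" using y by (simp add: order_less_trans)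
        then have "ennreal (norm (\<phi> (x \<ominus> y))) \<le> dual_norm X \<phi> * enorm X (x \<ominus> y)"
          using x y by (intro norm_le_dual_norm[OF lin]) auto
        also have "\<dots> \<le> ennreal d * ennreal (e / (d + 1))"
          using y d by (intro mult_mono) auto
        also have "\<dots> = ennreal (d * (e / (d + 1)))" using d e by (intro ennreal_mult[symmetric]) auto
        finally have "norm (\<phi> (x \<ominus> y)) \<le> d * (e / (d + 1))" using d e by simp
        also have "\<dots> < e" using d e by (simp add: field_simps)
        finally have "dist (\<phi> x) (\<phi> y) < e"
          using x y by (simp add: linear_functional_diff[OF lin] dist_norm)
        then show ?thesis using e by auto
      qed
      then show ?thesis using d e by (intro exI[of _ "e / (d + 1)"]) auto
    qed
    then show "openin (enls_topology X) {x \<in> topspace (enls_topology X). \<phi> x \<in> W}"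
      unfolding openin_enls_topology by (auto simp: topspace_enls_topology)
  qed
  ultimately show ?thesis by (auto simp: dual_def)
qed

lemma extended_seminorm_dual_norm: "extended_seminorm (dual_space X) (dual_norm X)"
  unfolding dual_norm_def by (rule extended_seminorm_sup_seminorm) auto

lemma dual_comb_closed:
  assumes "\<phi> \<in> carrier (dual_space X)" "\<psi> \<in> carrier (dual_space X)"
  shows "(\<lambda>x\<in>carrier X. \<phi> x + c * \<psi> x) \<in> carrier (dual_space X)"
proof -
  have "dual_norm X (\<lambda>x\<in>carrier X. \<phi> x + c * \<psi> x) = dual_norm X (\<lambda>x. \<phi> x + c * \<psi> x)"
    unfolding dual_norm_def by (rule sup_seminorm_cong) auto
  also have "\<dots> \<le> dual_norm X \<phi> + ennreal (norm c) * dual_norm X \<psi>"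
    unfolding dual_norm_def by (rule order_trans[OF sup_seminorm_add]) (simp add: sup_seminorm_mult)
  also have "\<dots> < \<infinity>" using assms by (simp add: mem_dual_iff ennreal_mult_less_top)
  finally show ?thesis using assms by (simp add: mem_dual_iff linear_functional_comb)
qed

lemma zero_mem_dual: "(\<lambda>x\<in>carrier X. 0) \<in> carrier (dual_space X)"
proof -
  have "dual_norm X (\<lambda>x\<in>carrier X. 0) \<le> 0"
    unfolding dual_norm_def by (rule sup_seminorm_le) auto
  then show ?thesis by (simp add: mem_dual_iff linear_functional_def)
qed

lemma dual_restrict: "\<phi> \<in> carrier (dual_space X) \<Longrightarrow> restrict \<phi> (carrier X) = \<phi>"
  by (simp add: mem_dual_iff linear_functional_def extensional_restrict)

lemma dual_add_closed:
  "\<lbrakk>\<phi> \<in> carrier (dual_space X); \<psi> \<in> carrier (dual_space X)\<rbrakk>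
    \<Longrightarrow> (\<lambda>x\<in>carrier X. \<phi> x + \<psi> x) \<in> carrier (dual_space X)"
  using dual_comb_closed[of \<phi> \<psi> 1] by simp

lemma dual_smult_closed:
  assumes "\<phi> \<in> carrier (dual_space X)"
  shows "(\<lambda>x\<in>carrier X. c * \<phi> x) \<in> carrier (dual_space X)"
proof -
  have "(\<lambda>x\<in>carrier X. c * \<phi> x) = (\<lambda>x\<in>carrier X. (\<lambda>x\<in>carrier X. 0) x + c * \<phi> x)"
    by (rule restrict_ext) simp
  then show ?thesis using dual_comb_closed[OF zero_mem_dual assms] by metis
qed

lemma dual_vector_space_record: "vector_space_record (dual_space X)"
proof -
  \<comment> \<open>The unit laws return a restricted copy of \<open>\<phi>\<close>, which equals
    \<open>\<phi>\<close> because members of the dual are extensional.\<close>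
  have ext: "restrict f (carrier X) = \<phi>"
    if "\<phi> \<in> carrier (dual_space X)" "\<And>x. x \<in> carrier X \<Longrightarrow> f x = \<phi> x" for f \<phi>
    using dual_restrict[OF that(1)] that(2) by (metis restrict_ext)
  have "abelian_group (dual_space X)"
  proof (rule abelian_groupI)
    fix \<phi> assume \<phi>: "\<phi> \<in> carrier (dual_space X)"
    have "(\<lambda>x\<in>carrier X. - 1 * \<phi> x) \<in> carrier (dual_space X)"
      by (rule dual_smult_closed) (rule \<phi>)
    moreover have "(\<lambda>x\<in>carrier X. - 1 * \<phi> x) \<oplus>\<^bsub>dual_space X\<^esub> \<phi> = \<zero>\<^bsub>dual_space X\<^esub>"
      by (auto simp: dual_simps)
    ultimately show "\<exists>\<psi>\<in>carrier (dual_space X). \<psi> \<oplus>\<^bsub>dual_space X\<^esub> \<phi> = \<zero>\<^bsub>dual_space X\<^esub>" by blast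
    show "\<zero>\<^bsub>dual_space X\<^esub> \<oplus>\<^bsub>dual_space X\<^esub> \<phi> = \<phi>"
      unfolding dual_simps by (rule ext[OF \<phi>]) simp
  qed (auto simp: dual_simps dual_add_closed zero_mem_dual algebra_simps)
  then have "module cring_class_ops (dual_space X)"
  proof (rule moduleI[OF R.is_cring])
    fix \<phi> assume \<phi>: "\<phi> \<in> carrier (dual_space X)"
    show "\<one>\<^bsub>cring_class_ops\<^esub> \<odot>\<^bsub>dual_space X\<^esub> \<phi> = \<phi>"
      unfolding dual_simps by (rule ext[OF \<phi>]) (simp add: one_class)
  qed (auto simp: dual_simps dual_smult_closed plus_class times_class algebra_simps)
  then show ?thesis by (simp add: vector_space_record_def)
qed

end

section \<open>Bounded sets and the bidual\<close>

lemma bounded_inE: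
  assumes "bounded_in V T A" "openin T W" "\<zero>\<^bsub>V\<^esub> \<in> W" "W \<subseteq> carrier V"
  obtains r F where "0 < r" "finite F" "F \<subseteq> carrier V"
    "A \<subseteq> F <+>\<^bsub>V\<^esub> (\<lambda>u. of_real r \<odot>\<^bsub>V\<^esub> u) ` W"
proof -
  have "\<exists>r>0. \<exists>F. finite F \<and> F \<subseteq> carrier V \<and> A \<subseteq> F <+>\<^bsub>V\<^esub> (\<lambda>u. of_real r \<odot>\<^bsub>V\<^esub> u) ` W"
    using assms unfolding bounded_in_def by blast
  then show ?thesis using that by blast
qed

lemma bounded_in_empty: "bounded_in V T {}"
  by (auto simp: bounded_in_def intro: exI[of _ 1] exI[of _ "{}"])

lemma openin_ucb_subbasis:
  assumes "bounded_in V T B" "\<phi> \<in> carrier (dual V T)" "0 < \<epsilon>"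
  shows "openin (ucb_topology V T)
    {\<psi> \<in> carrier (dual V T). sup_seminorm B (\<lambda>x. \<psi> x - \<phi> x) < ennreal \<epsilon>}"
  unfolding ucb_topology_def
  by (rule topology_generated_by_Basis, rule CollectI,
      rule exI[of _ B], rule exI[of _ \<phi>], rule exI[of _ \<epsilon>]) (simp add: assms)

lemma topspace_ucb_topology: "topspace (ucb_topology V T) = carrier (dual V T)"
proof
  show "topspace (ucb_topology V T) \<subseteq> carrier (dual V T)"
    unfolding ucb_topology_def topology_generated_by_topspace by auto
  show "carrier (dual V T) \<subseteq> topspace (ucb_topology V T)"
  proof
    fix \<phi> assume \<phi>: "\<phi> \<in> carrier (dual V T)"
    \<comment> \<open>The empty set is bounded and its seminorm is 0, so this subbasic set is the
      whole dual.\<close>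
    have "\<phi> \<in> {\<psi> \<in> carrier (dual V T). sup_seminorm {} (\<lambda>x. \<psi> x - \<phi> x) < ennreal 1}"
      using \<phi> by (simp add: sup_seminorm_def bot_ennreal)
    then show "\<phi> \<in> topspace (ucb_topology V T)"
      using openin_subset[OF openin_ucb_subbasis[OF bounded_in_empty \<phi> zero_less_one]] by blast
  qed
qed

context enls
begin

lemma openin_unit_ball: "openin (enls_topology X) {x \<in> carrier X. enorm X x < 1}"
  unfolding openin_enls_topology
proof (intro conjI ballI)
  fix x assume "x \<in> {x \<in> carrier X. enorm X x < 1}"
  then have x: "x \<in> carrier X" "enorm X x < 1" by auto
  then have "enorm X x < \<infinity>" by (metis ennreal_one_less_top infinity_ennreal_def order_less_trans)
  then obtain t where t: "enorm X x = ennreal t" "0 \<le> t" by (cases "enorm X x") auto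
  have "t < 1" using x t by (simp add: ennreal_less_one_iff)
  have "enorm X y < 1" if y: "y \<in> carrier X" "enorm X (x \<ominus> y) < ennreal (1 - t)" for y
  proof -
    have "y = x \<ominus> (x \<ominus> y)" using x y by (simp add: a_minus_def M.minus_add M.r_neg1 M.r_neg2)
    then have "enorm X y \<le> enorm X x + enorm X (x \<ominus> y)"
      using x y enorm_diff_le[of x "x \<ominus> y"] by simp
    also have "\<dots> < ennreal t + ennreal (1 - t)"
      using t y by (simp add: ennreal_add_left_cancel_less)
    also have "\<dots> = 1" using t \<open>t < 1\<close> by (simp flip: ennreal_plus)
    finally show ?thesis .
  qed
  then show "\<exists>r>0. \<forall>y\<in>carrier X. enorm X (x \<ominus> y) < ennreal r \<longrightarrow> y \<in> {x \<in> carrier X. enorm X x < 1}"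
    using \<open>t < 1\<close> by (intro exI[of _ "1 - t"]) auto
qed auto

text \<open>A ball of radius \<open>s\<close> inside \<open>U\<close> absorbs the unit ball with
  factor \<open>1 / s\<close>. Points of \<open>F\<close> may have infinite norm and escape every
  multiple of the ball, so they go into the finite part; \<open>\<zero>\<close> is added to it to
  serve the unit ball.\<close>

lemma bounded_in_finite_Un_ball:
  assumes F: "finite F" "F \<subseteq> carrier X"
  shows "bounded_in X (enls_topology X) (F \<union> {x \<in> carrier X. enorm X x < 1})"
  unfolding bounded_in_def
proof (intro conjI allI impI)
  show "F \<union> {x \<in> carrier X. enorm X x < 1} \<subseteq> carrier X" using F by auto
  fix U assume "U \<subseteq> carrier X \<and> (\<exists>W. openin (enls_topology X) W \<and> \<zero> \<in> W \<and> W \<subseteq> U)"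
  then obtain W where W: "openin (enls_topology X) W" "\<zero> \<in> W" "W \<subseteq> U" by blast
  then obtain s where s: "s > 0" "\<forall>y\<in>carrier X. enorm X (\<zero> \<ominus> y) < ennreal s \<longrightarrow> y \<in> W"
    unfolding openin_enls_topology by blast
  have "x \<in> insert \<zero> F <+>\<^bsub>X\<^esub> (\<lambda>u. of_real (1 / s) \<odot> u) ` U"
    if "x \<in> F \<union> {x \<in> carrier X. enorm X x < 1}" for x
    using that
  proof
    assume "x \<in> F"
    moreover have "x = x \<oplus> of_real (1 / s) \<odot> \<zero>"
      using F \<open>x \<in> F\<close> by (simp add: smult_zero subset_iff)
    ultimately show ?thesis using W unfolding set_add_def' by blast
  next
    assume "x \<in> {x \<in> carrier X. enorm X x < 1}"
    then have x: "x \<in> carrier X" "enorm X x < 1" by auto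
    have "ennreal s * enorm X x < ennreal s * 1"
      using x s by (intro ennreal_mult_strict_left_mono) auto
    then have "of_real s \<odot> x \<in> W" using s x by (simp add: enorm_zero_diff enorm_smult)
    moreover have "x = \<zero> \<oplus> of_real (1 / s) \<odot> (of_real s \<odot> x)"
      using x s by (simp add: smult_smult smult_1)
    ultimately show ?thesis using W unfolding set_add_def' by blast
  qed
  then show "\<exists>r>0. \<exists>F'. finite F' \<and> F' \<subseteq> carrier X \<and>
      F \<union> {x \<in> carrier X. enorm X x < 1} \<subseteq> F' <+>\<^bsub>X\<^esub> (\<lambda>u. of_real r \<odot> u) ` U"
    using s F by (intro exI[of _ "1 / s"] conjI exI[of _ "insert \<zero> F"]) auto
qed

text \<open>Boundedness tested against the unit ball, expressed through seminorms. It is stated for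
  pointwise differences, the form in which subbasic sets of \<open>ucb_topology\<close> use
  it.\<close>

lemma sup_seminorm_bounded_le:
  assumes "bounded_in X (enls_topology X) B"
  shows "\<exists>F C. finite F \<and> F \<subseteq> carrier X \<and> 0 \<le> C \<and>
    (\<forall>\<phi> \<psi>. linear_functional X \<phi> \<longrightarrow> linear_functional X \<psi> \<longrightarrow>
      sup_seminorm B (\<lambda>x. \<psi> x - \<phi> x) \<le> ennreal C *
        (dual_norm X (\<lambda>x. \<psi> x - \<phi> x) + (\<Sum>a\<in>F. ennreal (norm (\<psi> a - \<phi> a)))))"
proof -
  let ?U = "{x \<in> carrier X. enorm X x < 1}"
  have "\<zero> \<in> ?U" by (simp add: enorm_zero)
  then obtain r F where r: "0 < r" and F: "finite F" "F \<subseteq> carrier X"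
    and B: "B \<subseteq> F <+>\<^bsub>X\<^esub> (\<lambda>u. of_real r \<odot> u) ` ?U"
    using bounded_inE[OF assms openin_unit_ball] by blast
  have "sup_seminorm B (\<lambda>x. \<psi> x - \<phi> x) \<le> ennreal (1 + r) *
        (dual_norm X (\<lambda>x. \<psi> x - \<phi> x) + (\<Sum>a\<in>F. ennreal (norm (\<psi> a - \<phi> a))))"
    if \<phi>: "linear_functional X \<phi>" and \<psi>: "linear_functional X \<psi>" for \<phi> \<psi>
  proof (rule sup_seminorm_le)
    let ?d = "dual_norm X (\<lambda>x. \<psi> x - \<phi> x)" and ?s = "\<Sum>a\<in>F. ennreal (norm (\<psi> a - \<phi> a))"
    fix b assume "b \<in> B"
    then obtain f u where fu: "f \<in> F" "u \<in> ?U" "b = f \<oplus> of_real r \<odot> u"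
      using B unfolding set_add_def' by blast
    have car: "f \<in> carrier X" "u \<in> carrier X" using fu F by auto
    have "\<psi> b - \<phi> b = (\<psi> f - \<phi> f) + of_real r * (\<psi> u - \<phi> u)"
      using fu(3) car by (simp add: linear_functionalD(2,3)[OF \<phi>] linear_functionalD(2,3)[OF \<psi>] algebra_simps)
    then have "ennreal (norm (\<psi> b - \<phi> b)) \<le>
        ennreal (norm (\<psi> f - \<phi> f)) + ennreal (norm (of_real r * (\<psi> u - \<phi> u)))"
      by (simp add: ennreal_norm_triangle del: ennreal_plus)
    also have "ennreal (norm (of_real r * (\<psi> u - \<phi> u))) = ennreal r * ennreal (norm (\<psi> u - \<phi> u))"
      using r by (simp add: ennreal_norm_mult)
    also have "\<dots> \<le> ennreal r * ?d"
      unfolding dual_norm_def using fu by (intro mult_left_mono norm_le_sup_seminorm[of u _ "\<lambda>x. \<psi> x - \<phi> x"]) auto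
    also have "ennreal (norm (\<psi> f - \<phi> f)) \<le> ?s"
      using fu F by (intro member_le_sum) auto
    \<comment> \<open>Adding the cross terms turns the bound into a product with the single factor
      \<open>1 + r\<close>.\<close>
    also have "?s + ennreal r * ?d \<le> (?s + ennreal r * ?d) + (?d + ennreal r * ?s)" by simp
    also have "\<dots> = ennreal (1 + r) * (?d + ?s)"
      using r by (simp add: ennreal_plus distrib_left distrib_right ac_simps)
    finally show "ennreal (norm (\<psi> b - \<phi> b)) \<le> ennreal (1 + r) * (?d + ?s)"
      by (simp add: add_right_mono del: ennreal_plus)
  qed
  moreover have "0 \<le> 1 + r" using r by simp
  ultimately show ?thesis using F by blast
qed

text \<open>Induction over the generation of the topology; only subbasic sets need an estimate.
  Dual-norm balls cut down by finitely many evaluations are thus small enough for every open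
  set.\<close>

lemma ucb_neighbourhood:
  assumes "openin (ucb_topology X (enls_topology X)) W" "\<phi> \<in> W"
  shows "\<exists>A \<epsilon>. finite A \<and> A \<subseteq> carrier X \<and> \<epsilon> > 0 \<and>
    (\<forall>\<psi>\<in>carrier (dual_space X). dual_norm X (\<lambda>x. \<psi> x - \<phi> x) < ennreal \<epsilon> \<and>
        (\<forall>a\<in>A. norm (\<psi> a - \<phi> a) < \<epsilon>) \<longrightarrow> \<psi> \<in> W)"
  using assms(1)[unfolded ucb_topology_def openin_topology_generated_by_iff] assms(2)
proof (induction arbitrary: \<phi>)
  case (Int V W)
  obtain A e where A: "finite A" "A \<subseteq> carrier X" "e > 0"
    "\<forall>\<psi>\<in>carrier (dual_space X). dual_norm X (\<lambda>x. \<psi> x - \<phi> x) < ennreal e \<and>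
        (\<forall>a\<in>A. norm (\<psi> a - \<phi> a) < e) \<longrightarrow> \<psi> \<in> V"
    using Int.IH(1)[of \<phi>] Int.prems by blast
  obtain A' e' where A': "finite A'" "A' \<subseteq> carrier X" "e' > 0"
    "\<forall>\<psi>\<in>carrier (dual_space X). dual_norm X (\<lambda>x. \<psi> x - \<phi> x) < ennreal e' \<and>
        (\<forall>a\<in>A'. norm (\<psi> a - \<phi> a) < e') \<longrightarrow> \<psi> \<in> W"
    using Int.IH(2)[of \<phi>] Int.prems by blast
  have le: "ennreal (min e e') \<le> ennreal e" "ennreal (min e e') \<le> ennreal e'"
    by (simp_all add: ennreal_leI)
  have "\<psi> \<in> V \<inter> W"
    if \<psi>: "\<psi> \<in> carrier (dual_space X)" "dual_norm X (\<lambda>x. \<psi> x - \<phi> x) < ennreal (min e e')"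
      "\<forall>a\<in>A \<union> A'. norm (\<psi> a - \<phi> a) < min e e'" for \<psi>
    using A(4) A'(4) \<psi> le by (meson IntI UnI1 UnI2 min_less_iff_conj order_less_le_trans)
  then show ?case using A(1-3) A'(1-3)
    by (intro exI[of _ "A \<union> A'"] exI[of _ "min e e'"]) auto
next
  case (UN K)
  then obtain V where "V \<in> K" "\<phi> \<in> V" by blast
  then obtain A e where A: "finite A" "A \<subseteq> carrier X" "e > 0"
    "\<forall>\<psi>\<in>carrier (dual_space X). dual_norm X (\<lambda>x. \<psi> x - \<phi> x) < ennreal e \<and>
        (\<forall>a\<in>A. norm (\<psi> a - \<phi> a) < e) \<longrightarrow> \<psi> \<in> V"
    using UN.IH[of V \<phi>] by blast
  then show ?case using \<open>V \<in> K\<close> by (intro exI[of _ A] exI[of _ e]) blast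
next
  case (Basis S)
  then obtain B \<phi>0 e where S: "S = {\<psi> \<in> carrier (dual_space X). sup_seminorm B (\<lambda>x. \<psi> x - \<phi>0 x) < ennreal e}"
    and B: "bounded_in X (enls_topology X) B" by blast
  have \<phi>: "\<phi> \<in> carrier (dual_space X)" "sup_seminorm B (\<lambda>x. \<phi> x - \<phi>0 x) < ennreal e"
    using Basis S by auto
  obtain s where s: "sup_seminorm B (\<lambda>x. \<phi> x - \<phi>0 x) = ennreal s" "0 \<le> s" "s < e"
    using \<phi>(2) by (cases "sup_seminorm B (\<lambda>x. \<phi> x - \<phi>0 x)") (auto simp: ennreal_less_iff)
  obtain F C where F: "finite F" "F \<subseteq> carrier X" "0 \<le> C"
    "\<And>\<phi> \<psi>. \<lbrakk>linear_functional X \<phi>; linear_functional X \<psi>\<rbrakk> \<Longrightarrow>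
      sup_seminorm B (\<lambda>x. \<psi> x - \<phi> x) \<le> ennreal C *
        (dual_norm X (\<lambda>x. \<psi> x - \<phi> x) + (\<Sum>a\<in>F. ennreal (norm (\<psi> a - \<phi> a))))"
    using sup_seminorm_bounded_le[OF B] by blast
  \<comment> \<open>The slack \<open>e - s\<close> is divided by the total weight of the bound, one
    unit for the dual norm and one per point of \<open>F\<close>, times \<open>C\<close>. The
    \<open>+ 1\<close> makes the divisor positive and the result strict.\<close>
  define \<delta> where "\<delta> = (e - s) / (C * (1 + real (card F)) + 1)"
  have den: "C * (1 + real (card F)) + 1 > 0" using F by (simp add: add_nonneg_pos)
  have "\<delta> > 0" using s den by (simp add: \<delta>_def)
  have "\<psi> \<in> S" if \<psi>: "\<psi> \<in> carrier (dual_space X)" "dual_norm X (\<lambda>x. \<psi> x - \<phi> x) < ennreal \<delta>"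
    "\<forall>a\<in>F. norm (\<psi> a - \<phi> a) < \<delta>" for \<psi>
  proof -
    have "sup_seminorm B (\<lambda>x. \<psi> x - \<phi> x) \<le> ennreal C *
        (dual_norm X (\<lambda>x. \<psi> x - \<phi> x) + (\<Sum>a\<in>F. ennreal (norm (\<psi> a - \<phi> a))))"
      using \<phi> \<psi> by (intro F) (auto simp: mem_dual_iff)
    also have "\<dots> \<le> ennreal C * (ennreal \<delta> + (\<Sum>a\<in>F. ennreal \<delta>))"
      using \<psi> by (intro mult_left_mono add_mono sum_mono) (auto intro: ennreal_leI less_imp_le)
    also have "\<dots> = ennreal (C * (\<delta> + (\<Sum>a\<in>F. \<delta>)))"
      using F(3) \<open>\<delta> > 0\<close> by (simp add: ennreal_mult ennreal_of_nat_eq_real_of_nat)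
    also have "C * (\<delta> + (\<Sum>a\<in>F. \<delta>)) = C * (1 + real (card F)) * \<delta>"
      by (simp add: algebra_simps)
    finally have 1: "sup_seminorm B (\<lambda>x. \<psi> x - \<phi> x) \<le> ennreal (C * (1 + real (card F)) * \<delta>)" .
    have "sup_seminorm B (\<lambda>x. \<psi> x - \<phi>0 x) = sup_seminorm B (\<lambda>x. (\<psi> x - \<phi> x) + (\<phi> x - \<phi>0 x))"
      by simp
    also have "\<dots> \<le> sup_seminorm B (\<lambda>x. \<psi> x - \<phi> x) + sup_seminorm B (\<lambda>x. \<phi> x - \<phi>0 x)"
      by (rule sup_seminorm_add)
    also have "\<dots> \<le> ennreal (C * (1 + real (card F)) * \<delta>) + ennreal s"
      using 1 s by (intro add_mono) auto
    also have "\<dots> = ennreal (C * (1 + real (card F)) * \<delta> + s)"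
      using F s \<open>\<delta> > 0\<close> by (intro ennreal_plus[symmetric]) auto
    also have "\<dots> < ennreal e"
    proof -
      have "(C * (1 + real (card F)) + 1) * \<delta> = e - s" using den by (simp add: \<delta>_def)
      then have "C * (1 + real (card F)) * \<delta> + s < e" using \<open>\<delta> > 0\<close> by (simp add: algebra_simps)
      then show ?thesis using s by (intro ennreal_lessI) auto
    qed
    finally have "sup_seminorm B (\<lambda>x. \<psi> x - \<phi>0 x) < ennreal e" .
    then show ?thesis using S \<psi> by blast
  qed
  then show ?case using F \<open>\<delta> > 0\<close> by blast
qed auto

end

section \<open>The bidual and the canonical map\<close>

abbreviation bidual_space ::
    "('k::real_normed_field, 'a) enorm_space \<Rightarrow> ('k, ('a \<Rightarrow> 'k) \<Rightarrow> 'k) module" where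
  "bidual_space X \<equiv> bidual X (enls_topology X)"

context enls
begin

sublocale D: vector_space_record "dual_space X"
  by (rule dual_vector_space_record)

text \<open>Continuity at zero makes \<open>F\<close> smaller than 1 on a basic neighbourhood of
  size \<open>e\<close>; scaling an arbitrary functional into it gives the constant
  \<open>1 / e\<close>.\<close>

lemma bidual_bound:
  assumes F: "F \<in> carrier (bidual_space X)"
  obtains A C where "finite A" "A \<subseteq> carrier X"
    "\<And>\<phi>. \<phi> \<in> carrier (dual_space X) \<Longrightarrow> ennreal (norm (F \<phi>)) \<le>
      ennreal C * (dual_norm X \<phi> + (\<Sum>a\<in>A. ennreal (norm (\<phi> a))))"
proof -
  let ?T = "enls_topology X"
  have lin: "linear_functional (dual_space X) F"
    and cont: "continuous_map (ucb_topology X ?T) euclidean F"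
    using F by (auto simp: dual_def)
  let ?W = "{\<phi> \<in> carrier (dual_space X). F \<phi> \<in> ball 0 1}"
  let ?z = "\<lambda>x\<in>carrier X. 0::'k"
  have "openin (ucb_topology X ?T) ?W"
    using openin_continuous_map_preimage[OF cont, of "ball 0 1"] by (simp add: topspace_ucb_topology)
  moreover have "?z \<in> ?W"
    using D.linear_functional_zero[OF lin] zero_mem_dual by (simp add: dual_simps)
  ultimately obtain A e where A: "finite A" "A \<subseteq> carrier X" and e: "e > 0"
    and W: "\<And>\<psi>. \<lbrakk>\<psi> \<in> carrier (dual_space X); dual_norm X (\<lambda>x. \<psi> x - ?z x) < ennreal e;
      \<forall>a\<in>A. norm (\<psi> a - ?z a) < e\<rbrakk> \<Longrightarrow> \<psi> \<in> ?W"
    using ucb_neighbourhood[of ?W ?z] by blast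
  have "ennreal (norm (F \<phi>)) \<le> ennreal (1 / e) * (dual_norm X \<phi> + (\<Sum>a\<in>A. ennreal (norm (\<phi> a))))"
    if \<phi>: "\<phi> \<in> carrier (dual_space X)" for \<phi>
  proof -
    obtain d where d: "dual_norm X \<phi> = ennreal d" "0 \<le> d"
      using \<phi> by (cases "dual_norm X \<phi>") (auto simp: mem_dual_iff)
    define m where "m = d + (\<Sum>a\<in>A. norm (\<phi> a))"
    have "0 \<le> m" using d by (simp add: m_def sum_nonneg)
    have "d \<le> m" by (simp add: m_def sum_nonneg)
    have a_le: "norm (\<phi> a) \<le> m" if "a \<in> A" for a
      using member_le_sum[of a A "\<lambda>a. norm (\<phi> a)"] that A d by (simp add: m_def)
    \<comment> \<open>The number \<open>m\<close> bounds the dual norm and all evaluations at once.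
      For every \<open>s > m\<close> the multiple \<open>e / s\<close> of \<open>\<phi>\<close>
      satisfies the strict inequalities of the neighbourhood; letting \<open>s\<close> decrease to
      \<open>m\<close> also covers \<open>m = 0\<close>.\<close>
    have "norm (F \<phi>) * e \<le> m"
    proof (rule dense_ge)
      fix s assume s: "m < s"
      then have "0 < s" using \<open>0 \<le> m\<close> by simp
      let ?c = "of_real (e / s) :: 'k"
      let ?\<psi> = "?c \<odot>\<^bsub>dual_space X\<^esub> \<phi>"
      have nc: "norm ?c = e / s" using e \<open>0 < s\<close> by (simp add: norm_divide)
      have "?\<psi> \<in> ?W"
      proof (rule W)
        show "?\<psi> \<in> carrier (dual_space X)" using \<phi> by simp
        have "dual_norm X (\<lambda>x. ?\<psi> x - ?z x) = dual_norm X ?\<psi>"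
          unfolding dual_norm_def by (rule sup_seminorm_cong) auto
        also have "\<dots> = ennreal (e / s) * ennreal d"
          unfolding extended_seminormD(2)[OF extended_seminorm_dual_norm \<phi>] nc d(1) ..
        also have "\<dots> = ennreal (e / s * d)"
          using d e \<open>0 < s\<close> by (intro ennreal_mult[symmetric]) auto
        also have "\<dots> < ennreal e"
          using e s \<open>d \<le> m\<close> \<open>0 < s\<close> by (intro ennreal_lessI) (simp_all add: field_simps)
        finally show "dual_norm X (\<lambda>x. ?\<psi> x - ?z x) < ennreal e" .
        show "\<forall>a\<in>A. norm (?\<psi> a - ?z a) < e"
        proof
          fix a assume a: "a \<in> A"
          have "?\<psi> a - ?z a = ?c * \<phi> a" using a A by (simp add: dual_simps subset_iff)
          then have "norm (?\<psi> a - ?z a) = e / s * norm (\<phi> a)" by (simp only: norm_mult nc)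
          also have "\<dots> < e"
            using e s a_le[OF a] \<open>0 < s\<close> by (simp add: field_simps)
          finally show "norm (?\<psi> a - ?z a) < e" .
        qed
      qed
      then have "norm (?c * F \<phi>) < 1" using linear_functionalD(3)[OF lin \<phi>, of ?c] by simp
      then show "norm (F \<phi>) * e \<le> s"
        unfolding norm_mult nc using \<open>0 < s\<close> by (simp add: field_simps)
    qed
    then have "norm (F \<phi>) \<le> 1 / e * m" using e by (simp add: field_simps)
    then have "ennreal (norm (F \<phi>)) \<le> ennreal (1 / e * m)" by (rule ennreal_leI)
    also have "\<dots> = ennreal (1 / e) * ennreal m" using e \<open>0 \<le> m\<close> by (intro ennreal_mult) auto
    also have "ennreal m = dual_norm X \<phi> + (\<Sum>a\<in>A. ennreal (norm (\<phi> a)))"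
      using d by (simp add: m_def sum_nonneg)
    finally show ?thesis .
  qed
  then show ?thesis using that A by blast
qed

text \<open>The union of \<open>A\<close> and the unit ball is a single bounded set whose seminorm
  dominates the dual norm and every evaluation at a point of \<open>A\<close>, so \<open>F\<close>
  is Lipschitz for one defining seminorm.\<close>

lemma bidual_memI:
  assumes lin: "linear_functional (dual_space X) F" and A: "finite A" "A \<subseteq> carrier X"
    and bound: "\<And>\<phi>. \<phi> \<in> carrier (dual_space X) \<Longrightarrow> ennreal (norm (F \<phi>)) \<le>
      ennreal C * (dual_norm X \<phi> + (\<Sum>a\<in>A. ennreal (norm (\<phi> a))))"
  shows "F \<in> carrier (bidual_space X)"
proof -
  let ?T = "enls_topology X"
  let ?B = "A \<union> {x \<in> carrier X. enorm X x < 1}"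
  have B: "bounded_in X ?T ?B" by (rule bounded_in_finite_Un_ball) (rule A)+
  \<comment> \<open>A Lipschitz constant: one unit for the dual norm and one per evaluation. The
    absolute value covers negative \<open>C\<close>, where \<open>ennreal C = 0\<close>, and
    \<open>+ 1\<close> keeps \<open>n\<close> positive.\<close>
  define n where "n = \<bar>C\<bar> * (1 + real (card A)) + 1"
  have "n > 0" by (simp add: n_def add_nonneg_pos)
  have le: "norm (F \<psi> - F \<phi>) < e"
    if \<phi>: "\<phi> \<in> carrier (dual_space X)" and \<psi>: "\<psi> \<in> carrier (dual_space X)"
      and less: "sup_seminorm ?B (\<lambda>x. \<psi> x - \<phi> x) < ennreal (e / n)" for \<phi> \<psi> e
  proof -
    let ?d = "\<psi> \<oplus>\<^bsub>dual_space X\<^esub> (- 1) \<odot>\<^bsub>dual_space X\<^esub> \<phi>"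
    let ?s = "sup_seminorm ?B (\<lambda>x. \<psi> x - \<phi> x)"
    obtain s where s: "?s = ennreal s" "0 \<le> s" "s < e / n"
      using less by (cases ?s) (auto simp: ennreal_less_iff)
    have d: "?d \<in> carrier (dual_space X)" "F ?d = F \<psi> - F \<phi>"
      using \<phi> \<psi> by (auto simp: linear_functionalD[OF lin])
    have dx: "?d x = \<psi> x - \<phi> x" if "x \<in> carrier X" for x using that by (simp add: dual_simps)
    have "dual_norm X ?d \<le> ?s"
      unfolding dual_norm_def
      using norm_le_sup_seminorm[of _ ?B "\<lambda>x. \<psi> x - \<phi> x"] by (intro sup_seminorm_le) (simp add: dx)
    moreover have "ennreal (norm (?d a)) \<le> ?s" if "a \<in> A" for a
      using norm_le_sup_seminorm[of a ?B "\<lambda>x. \<psi> x - \<phi> x"] that A by (simp add: dx subset_iff)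
    ultimately have "dual_norm X ?d + (\<Sum>a\<in>A. ennreal (norm (?d a))) \<le> ennreal s + (\<Sum>a\<in>A. ennreal s)"
      unfolding s(1) by (intro add_mono sum_mono) auto
    also have "\<dots> = ennreal ((1 + real (card A)) * s)"
      using s by (simp add: ennreal_of_nat_eq_real_of_nat algebra_simps flip: ennreal_mult ennreal_plus)
    finally have sum_le: "dual_norm X ?d + (\<Sum>a\<in>A. ennreal (norm (?d a))) \<le> \<dots>" .
    have "ennreal (norm (F ?d)) \<le> ennreal C * (dual_norm X ?d + (\<Sum>a\<in>A. ennreal (norm (?d a))))"
      by (rule bound) (rule d)
    also have "\<dots> \<le> ennreal \<bar>C\<bar> * ennreal ((1 + real (card A)) * s)"
      by (intro mult_mono sum_le ennreal_leI) auto
    also have "\<dots> = ennreal (\<bar>C\<bar> * ((1 + real (card A)) * s))"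
      using s by (intro ennreal_mult[symmetric]) auto
    finally have "norm (F ?d) \<le> \<bar>C\<bar> * ((1 + real (card A)) * s)" using s by simp
    also have "\<dots> \<le> n * s" using s by (simp add: n_def algebra_simps)
    also have "\<dots> < e" using s \<open>n > 0\<close> by (simp add: field_simps)
    finally show ?thesis using d by simp
  qed
  have "continuous_map (ucb_topology X ?T) euclidean F"
    unfolding continuous_map_def
  proof (intro conjI allI impI)
    show "F \<in> topspace (ucb_topology X ?T) \<rightarrow> topspace euclidean" by auto
    fix W :: "'k set" assume "openin euclidean W"
    then have W: "open W" by simp
    show "openin (ucb_topology X ?T) {\<phi> \<in> topspace (ucb_topology X ?T). F \<phi> \<in> W}" (is "openin _ ?P")
    proof (subst openin_subopen, intro ballI)
      fix \<phi> assume "\<phi> \<in> ?P"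
      then have \<phi>: "\<phi> \<in> carrier (dual_space X)" "F \<phi> \<in> W" by (auto simp: topspace_ucb_topology)
      then obtain e where e: "e > 0" "ball (F \<phi>) e \<subseteq> W" using W open_contains_ball by blast
      let ?S = "{\<psi> \<in> carrier (dual_space X). sup_seminorm ?B (\<lambda>x. \<psi> x - \<phi> x) < ennreal (e / n)}"
      have "openin (ucb_topology X ?T) ?S"
        using B \<phi> e \<open>n > 0\<close> by (intro openin_ucb_subbasis) auto
      moreover have "sup_seminorm ?B (\<lambda>x. \<phi> x - \<phi> x) \<le> 0" by (rule sup_seminorm_le) simp
      then have "\<phi> \<in> ?S" using \<phi> e \<open>n > 0\<close> by simp
      moreover have "?S \<subseteq> ?P"
        using le[OF \<phi>(1)] e by (fastforce simp: topspace_ucb_topology dist_norm norm_minus_commute)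
      ultimately show "\<exists>S. openin (ucb_topology X ?T) S \<and> \<phi> \<in> S \<and> S \<subseteq> ?P" by blast
    qed
  qed
  then show ?thesis using lin by (simp add: dual_def)
qed

text \<open>Evaluation at \<open>x\<close> is dominated by its own seminorm, whence
  \<open>A = {x}\<close>; at a point of infinite norm the dual norm alone would not suffice.\<close>

lemma canonical_map_mem_bidual:
  assumes x: "x \<in> carrier X"
  shows "canonical_map X (enls_topology X) x \<in> carrier (bidual_space X)"
proof (rule bidual_memI[where A = "{x}" and C = 1])
  show "linear_functional (dual_space X) (canonical_map X (enls_topology X) x)"
    unfolding canonical_map_def using x
    by (intro D.linear_functional_restrict) (simp_all add: dual_simps)
qed (use x in \<open>auto simp: canonical_map_def add_increasing\<close>)

text \<open>The unit ball of \<open>X\<close> is bounded, so the open dual-norm unit ball is a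
  neighbourhood of zero. A bounded set lies in a finite set plus a multiple of it, and members of
  the finite set have finite dual norm. This yields continuity of the canonical map.\<close>

lemma bounded_in_dual_dual_norm:
  assumes D: "bounded_in (dual_space X) (ucb_topology X (enls_topology X)) D"
  shows "\<exists>M>0. \<forall>\<phi>\<in>D. dual_norm X \<phi> \<le> ennreal M"
proof -
  let ?B = "{x \<in> carrier X. enorm X x < 1}"
  let ?z = "\<lambda>x\<in>carrier X. 0::'k"
  let ?W = "{\<psi> \<in> carrier (dual_space X). sup_seminorm ?B (\<lambda>x. \<psi> x - ?z x) < ennreal 1}"
  have W: "dual_norm X \<psi> < 1" if "\<psi> \<in> ?W" for \<psi>
  proof -
    have "dual_norm X \<psi> = sup_seminorm ?B (\<lambda>x. \<psi> x - ?z x)"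
      unfolding dual_norm_def by (rule sup_seminorm_cong) auto
    then show ?thesis using that by simp
  qed
  have "bounded_in X (enls_topology X) ?B" using bounded_in_finite_Un_ball[of "{}"] by simp
  then have "openin (ucb_topology X (enls_topology X)) ?W"
    by (rule openin_ucb_subbasis[OF _ zero_mem_dual zero_less_one])
  moreover have "sup_seminorm ?B (\<lambda>x. ?z x - ?z x) \<le> 0" by (rule sup_seminorm_le) simp
  then have "\<zero>\<^bsub>dual_space X\<^esub> \<in> ?W" using zero_mem_dual by (simp add: dual_simps)
  moreover have "?W \<subseteq> carrier (dual_space X)" by auto
  ultimately obtain r F where r: "0 < r" and F: "finite F" "F \<subseteq> carrier (dual_space X)"
    and sub: "D \<subseteq> F <+>\<^bsub>dual_space X\<^esub> (\<lambda>u. of_real r \<odot>\<^bsub>dual_space X\<^esub> u) ` ?W"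
    using bounded_inE[OF D] by blast
  let ?M = "(\<Sum>f\<in>F. dual_norm X f) + ennreal r"
  have le: "dual_norm X \<phi> \<le> ?M" if \<phi>: "\<phi> \<in> D" for \<phi>
  proof -
    obtain f u where fu: "f \<in> F" "u \<in> ?W" "\<phi> = f \<oplus>\<^bsub>dual_space X\<^esub> of_real r \<odot>\<^bsub>dual_space X\<^esub> u"
      using subsetD[OF sub \<phi>] unfolding set_add_def' by blast
    have car: "f \<in> carrier (dual_space X)" "u \<in> carrier (dual_space X)" using fu F by auto
    have "dual_norm X \<phi> \<le> dual_norm X f + dual_norm X (of_real r \<odot>\<^bsub>dual_space X\<^esub> u)"
      using fu car by (auto intro: extended_seminormD(1)[OF extended_seminorm_dual_norm])
    also have "\<dots> \<le> (\<Sum>f\<in>F. dual_norm X f) + ennreal r * 1"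
    proof (rule add_mono)
      show "dual_norm X f \<le> (\<Sum>f\<in>F. dual_norm X f)" using fu F by (intro member_le_sum) auto
      show "dual_norm X (of_real r \<odot>\<^bsub>dual_space X\<^esub> u) \<le> ennreal r * 1"
        using W[OF fu(2)] r car
        by (simp only: extended_seminormD(2)[OF extended_seminorm_dual_norm])
          (intro mult_mono, auto)
    qed
    finally show ?thesis by simp
  qed
  have "?M < \<infinity>" using F by (auto simp: mem_dual_iff subset_iff)
  then obtain m where m: "?M = ennreal m" "0 \<le> m" by (cases ?M) auto
  \<comment> \<open>The bound is raised by 1 to be positive, since it later serves as a
    divisor.\<close>
  have "dual_norm X \<phi> \<le> ennreal (m + 1)" if "\<phi> \<in> D" for \<phi>
    using le[OF that] m by (auto intro: order_trans ennreal_leI)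
  then show ?thesis using m by (intro exI[of _ "m + 1"]) auto
qed

text \<open>On a bounded set of functionals the dual norms are at most some \<open>M\<close>, so the
  canonical map is locally \<open>M\<close>-Lipschitz for the associated seminorm.\<close>

lemma continuous_canonical_map:
  "continuous_map (enls_topology X) (bidual_topology X (enls_topology X))
    (canonical_map X (enls_topology X))"
proof -
  let ?T = "enls_topology X" and ?J = "canonical_map X (enls_topology X)"
  show ?thesis
    unfolding ucb_topology_def[of "dual_space X"]
  proof (rule continuous_on_generated_topo)
    fix U assume "U \<in> {{\<Psi> \<in> carrier (bidual_space X). sup_seminorm D (\<lambda>\<phi>. \<Psi> \<phi> - \<Phi> \<phi>) < ennreal \<epsilon>} |
        D \<Phi> \<epsilon>. bounded_in (dual_space X) (ucb_topology X ?T) D \<and> \<Phi> \<in> carrier (bidual_space X) \<and> \<epsilon> > 0}"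
    then obtain D \<Phi> \<epsilon> where U: "U = {\<Psi> \<in> carrier (bidual_space X). sup_seminorm D (\<lambda>\<phi>. \<Psi> \<phi> - \<Phi> \<phi>) < ennreal \<epsilon>}"
      and D: "bounded_in (dual_space X) (ucb_topology X ?T) D" by blast
    have Dc: "D \<subseteq> carrier (dual_space X)" using D by (simp add: bounded_in_def)
    obtain M where M: "M > 0" "\<And>\<phi>. \<phi> \<in> D \<Longrightarrow> dual_norm X \<phi> \<le> ennreal M"
      using bounded_in_dual_dual_norm[OF D] by blast
    have "\<exists>r>0. \<forall>y\<in>carrier X. enorm X (x \<ominus> y) < ennreal r \<longrightarrow> ?J y \<in> U"
      if x: "x \<in> carrier X" "?J x \<in> U" for x
    proof -
      obtain s where s: "sup_seminorm D (\<lambda>\<phi>. ?J x \<phi> - \<Phi> \<phi>) = ennreal s" "0 \<le> s" "s < \<epsilon>"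
        using x(2) U by (cases "sup_seminorm D (\<lambda>\<phi>. ?J x \<phi> - \<Phi> \<phi>)") (auto simp: ennreal_less_iff)
      \<comment> \<open>With this radius \<open>M * r\<close> is half of the slack
        \<open>\<epsilon> - s\<close>.\<close>
      define r where "r = (\<epsilon> - s) / (2 * M)"
      have "r > 0" using s M by (simp add: r_def)
      have "?J y \<in> U" if y: "y \<in> carrier X" "enorm X (x \<ominus> y) < ennreal r" for y
      proof -
        have "enorm X (x \<ominus> y) < \<infinity>" using y by (simp add: order_less_trans)
        have diff: "sup_seminorm D (\<lambda>\<phi>. ?J y \<phi> - ?J x \<phi>) \<le> ennreal (M * r)"
        proof (rule sup_seminorm_le)
          fix \<phi> assume \<phi>: "\<phi> \<in> D"
          then have lin: "linear_functional X \<phi>" "\<phi> \<in> carrier (dual_space X)"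
            using Dc by (auto simp: mem_dual_iff)
          have "norm (?J y \<phi> - ?J x \<phi>) = norm (\<phi> (x \<ominus> y))"
            using lin x y by (simp add: canonical_map_def linear_functional_diff norm_minus_commute)
          moreover have "ennreal (norm (\<phi> (x \<ominus> y))) \<le> dual_norm X \<phi> * enorm X (x \<ominus> y)"
            using x y \<open>enorm X (x \<ominus> y) < \<infinity>\<close> by (intro norm_le_dual_norm lin) auto
          moreover have "\<dots> \<le> ennreal M * ennreal r" using M(2)[OF \<phi>] y by (intro mult_mono) auto
          moreover have "\<dots> = ennreal (M * r)" using M \<open>r > 0\<close> by (simp add: ennreal_mult)
          ultimately show "ennreal (norm (?J y \<phi> - ?J x \<phi>)) \<le> ennreal (M * r)"
            by (metis order_trans)
        qed
        have "sup_seminorm D (\<lambda>\<phi>. ?J y \<phi> - \<Phi> \<phi>) =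
            sup_seminorm D (\<lambda>\<phi>. (?J y \<phi> - ?J x \<phi>) + (?J x \<phi> - \<Phi> \<phi>))" by simp
        also have "\<dots> \<le> sup_seminorm D (\<lambda>\<phi>. ?J y \<phi> - ?J x \<phi>) + sup_seminorm D (\<lambda>\<phi>. ?J x \<phi> - \<Phi> \<phi>)"
          by (rule sup_seminorm_add)
        also have "\<dots> \<le> ennreal (M * r) + ennreal s" using diff s by (intro add_mono) auto
        also have "\<dots> = ennreal (M * r + s)"
          using M s \<open>r > 0\<close> by (intro ennreal_plus[symmetric]) auto
        also have "\<dots> < ennreal \<epsilon>"
          using s M by (intro ennreal_lessI) (simp_all add: r_def field_simps)
        finally show ?thesis using U canonical_map_mem_bidual y by blast
      qed
      then show ?thesis using \<open>r > 0\<close> by blast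
    qed
    then show "openin ?T (?J -` U \<inter> topspace ?T)"
      unfolding openin_enls_topology by (auto simp: topspace_enls_topology)
  next
    have "?J \<in> carrier X \<rightarrow> topspace (ucb_topology (dual_space X) (ucb_topology X ?T))"
      unfolding topspace_ucb_topology using canonical_map_mem_bidual by blast
    then show "?J ` topspace ?T \<subseteq> \<Union> {{\<Psi> \<in> carrier (bidual_space X). sup_seminorm D (\<lambda>\<phi>. \<Psi> \<phi> - \<Phi> \<phi>) < ennreal \<epsilon>} |
        D \<Phi> \<epsilon>. bounded_in (dual_space X) (ucb_topology X ?T) D \<and> \<Phi> \<in> carrier (bidual_space X) \<and> \<epsilon> > 0}"
      unfolding ucb_topology_def[of "dual_space X"] topology_generated_by_topspace
        topspace_enls_topology by blast
  qed
qed

lemma reflexive_enls_iff_surj: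
  "reflexive_enls X \<longleftrightarrow> (\<forall>F\<in>carrier (bidual_space X). \<exists>x\<in>carrier X. \<forall>\<phi>\<in>carrier (dual_space X). F \<phi> = \<phi> x)"
proof -
  have ext: "F = canonical_map X (enls_topology X) x \<longleftrightarrow> (\<forall>\<phi>\<in>carrier (dual_space X). F \<phi> = \<phi> x)"
    if "F \<in> carrier (bidual_space X)" for F x
  proof -
    have "F \<in> extensional (carrier (dual_space X))"
      using that by (simp add: dual_def[of "dual_space X"] linear_functional_def)
    then show ?thesis
      by (auto simp: canonical_map_def intro!: extensionalityI[where A = "carrier (dual_space X)"])
  qed
  have "reflexive_enls X \<longleftrightarrow>
      carrier (bidual_space X) \<subseteq> canonical_map X (enls_topology X) ` carrier X"
    using canonical_map_mem_bidual continuous_canonical_map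
    by (auto simp: reflexive_enls_def Let_def)
  then show ?thesis using ext by (auto simp: subset_iff image_iff)
qed

end

section \<open>Reflexivity in terms of the dual norm\<close>

lemma extended_seminorm_sum_eval:
  assumes "A \<subseteq> carrier V"
  shows "extended_seminorm (dual V T) (\<lambda>\<phi>. \<Sum>a\<in>A. ennreal (norm (\<phi> a)))"
  unfolding extended_seminorm_def
proof (intro conjI ballI allI)
  show "(\<Sum>a\<in>A. ennreal (norm ((\<phi> \<oplus>\<^bsub>dual V T\<^esub> \<psi>) a))) \<le>
      (\<Sum>a\<in>A. ennreal (norm (\<phi> a))) + (\<Sum>a\<in>A. ennreal (norm (\<psi> a)))" for \<phi> \<psi>
    unfolding sum.distrib[symmetric] using assms
    by (intro sum_mono) (auto simp: dual_simps subset_iff simp del: ennreal_plus intro: ennreal_norm_triangle)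
  show "(\<Sum>a\<in>A. ennreal (norm ((c \<odot>\<^bsub>dual V T\<^esub> \<phi>) a))) =
      ennreal (norm c) * (\<Sum>a\<in>A. ennreal (norm (\<phi> a)))" for c \<phi>
    unfolding sum_distrib_left using assms
    by (intro sum.cong) (auto simp: dual_simps ennreal_norm_mult subset_iff)
qed

context enls
begin

lemma extended_seminorm_enorm: "extended_seminorm X (enorm X)"
  by (simp add: extended_seminorm_def enorm_smult enorm_triangle)

text \<open>Added to a dominating function, it removes every constraint outside the subspace of
  finite-norm vectors and changes nothing inside.\<close>

lemma extended_seminorm_infinite:
  "extended_seminorm X (\<lambda>x. if enorm X x = \<infinity> then \<infinity> else 0)"
  unfolding extended_seminorm_def
proof (intro conjI ballI allI)
  fix x y assume "x \<in> carrier X" "y \<in> carrier X"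
  from enorm_triangle[OF this]
  show "(if enorm X (x \<oplus> y) = \<infinity> then \<infinity> else 0) \<le>
      (if enorm X x = \<infinity> then \<infinity> else 0) + (if enorm X y = \<infinity> then \<infinity> else (0::ennreal))"
    by (auto simp: top_unique)
next
  fix c :: 'k and x assume "x \<in> carrier X"
  then show "(if enorm X (c \<odot> x) = \<infinity> then \<infinity> else 0) =
      ennreal (norm c) * (if enorm X x = \<infinity> then \<infinity> else (0::ennreal))"
    by (cases "c = 0") (auto simp: enorm_smult ennreal_mult_eq_top_iff)
qed

lemma submodule_annihilator:
  assumes "a \<in> carrier X"
  shows "submodule {\<phi> \<in> carrier (dual_space X). \<phi> a = 0} cring_class_ops (dual_space X)"
proof (rule D.subspaceI)
  show "\<zero>\<^bsub>dual_space X\<^esub> \<in> {\<phi> \<in> carrier (dual_space X). \<phi> a = 0}"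
    using assms zero_mem_dual by (simp add: dual_simps)
  fix \<phi> assume \<phi>: "\<phi> \<in> {\<phi> \<in> carrier (dual_space X). \<phi> a = 0}"
  then show "c \<odot>\<^bsub>dual_space X\<^esub> \<phi> \<in> {\<phi> \<in> carrier (dual_space X). \<phi> a = 0}" for c
    using assms dual_smult_closed by (simp add: dual_simps)
  fix \<psi> assume \<psi>: "\<psi> \<in> {\<phi> \<in> carrier (dual_space X). \<phi> a = 0}"
  show "\<phi> \<oplus>\<^bsub>dual_space X\<^esub> \<psi> \<in> {\<phi> \<in> carrier (dual_space X). \<phi> a = 0}"
    using assms dual_add_closed \<phi> \<psi> by (simp add: dual_simps)
qed auto

lemma dual_linear:
  assumes "\<phi> \<in> carrier (dual_space X)"
  shows "\<lbrakk>x \<in> carrier X; y \<in> carrier X\<rbrakk> \<Longrightarrow> \<phi> (x \<oplus> y) = \<phi> x + \<phi> y"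
    and "x \<in> carrier X \<Longrightarrow> \<phi> (c \<odot> x) = c * \<phi> x"
    and "\<lbrakk>x \<in> carrier X; y \<in> carrier X\<rbrakk> \<Longrightarrow> \<phi> (x \<ominus> y) = \<phi> x - \<phi> y"
    and "\<phi> \<zero> = 0"
proof -
  have "linear_functional X \<phi>" using assms by (simp add: mem_dual_iff)
  then show "\<lbrakk>x \<in> carrier X; y \<in> carrier X\<rbrakk> \<Longrightarrow> \<phi> (x \<oplus> y) = \<phi> x + \<phi> y"
    and "x \<in> carrier X \<Longrightarrow> \<phi> (c \<odot> x) = c * \<phi> x"
    and "\<lbrakk>x \<in> carrier X; y \<in> carrier X\<rbrakk> \<Longrightarrow> \<phi> (x \<ominus> y) = \<phi> x - \<phi> y"
    and "\<phi> \<zero> = 0"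
    by (simp_all add: linear_functionalD linear_functional_diff linear_functional_zero)
qed

lemma dual_eqI:
  assumes "\<phi> \<in> carrier (dual_space X)" "\<psi> \<in> carrier (dual_space X)"
    and "\<And>x. x \<in> carrier X \<Longrightarrow> \<phi> x = \<psi> x"
  shows "\<phi> = \<psi>"
  using assms by (metis dual_restrict restrict_ext)

lemma linear_functional_diff_eval:
  assumes F: "linear_functional (dual_space X) F" and w: "w \<in> carrier X"
  shows "linear_functional (dual_space X) (\<lambda>\<phi>\<in>carrier (dual_space X). F \<phi> - \<phi> w)"
proof (rule D.linear_functional_restrict)
  show "F (\<phi> \<oplus>\<^bsub>dual_space X\<^esub> \<psi>) - (\<phi> \<oplus>\<^bsub>dual_space X\<^esub> \<psi>) w = F \<phi> - \<phi> w + (F \<psi> - \<psi> w)"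
    if "\<phi> \<in> carrier (dual_space X)" "\<psi> \<in> carrier (dual_space X)" for \<phi> \<psi>
    unfolding linear_functionalD(2)[OF F that] using w by (simp add: dual_simps)
  show "F (c \<odot>\<^bsub>dual_space X\<^esub> \<phi>) - (c \<odot>\<^bsub>dual_space X\<^esub> \<phi>) w = c * (F \<phi> - \<phi> w)"
    if "\<phi> \<in> carrier (dual_space X)" for c \<phi>
    unfolding linear_functionalD(3)[OF F that] using w by (simp add: dual_simps right_diff_distrib)
qed

end

context scalar_real_part
begin

text \<open>
  Extending the restriction of \<open>F\<close> to \<open>{\<phi>. \<phi> a = 0}\<close>, where the summand of \<open>a\<close> vanishes, changes \<open>F\<close>
  only by a multiple of the evaluation at \<open>a\<close>.
\<close>

lemma split_off_evaluations:
  fixes X :: "('k, 'a) enorm_space" (structure)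
  assumes X: "enls X" and "finite A" "A \<subseteq> carrier X"
    and "linear_functional (dual_space X) F"
    and "\<And>\<phi>. \<phi> \<in> carrier (dual_space X) \<Longrightarrow> ennreal (norm (F \<phi>)) \<le>
      ennreal C * (dual_norm X \<phi> + (\<Sum>a\<in>A. ennreal (norm (\<phi> a))))"
  shows "\<exists>w\<in>carrier X. \<forall>\<phi>\<in>carrier (dual_space X).
    ennreal (norm (F \<phi> - \<phi> w)) \<le> ennreal C * dual_norm X \<phi>"
  using assms(2-)
proof (induction A arbitrary: F rule: finite_induct)
  case empty
  interpret enls X by (rule X)
  show ?case using empty by (intro bexI[of _ \<zero>]) (auto simp: dual_linear)
next
  case (insert a A)
  interpret enls X by (rule X)
  let ?M = "{\<phi> \<in> carrier (dual_space X). \<phi> a = 0}"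
  let ?p = "\<lambda>\<phi>. ennreal C * (dual_norm X \<phi> + (\<Sum>a\<in>A. ennreal (norm (\<phi> a))))"
  have a: "a \<in> carrier X" and A: "A \<subseteq> carrier X" using insert by auto
  note F = linear_functionalD[OF insert.prems(2)]
  have "\<exists>G. linear_functional (dual_space X) G \<and> (\<forall>\<phi>\<in>?M. G \<phi> = F \<phi>) \<and>
      (\<forall>\<phi>\<in>carrier (dual_space X). ennreal (norm (G \<phi>)) \<le> ?p \<phi>)"
  proof (rule hahn_banach)
    show "extended_seminorm (dual_space X) ?p"
      by (intro extended_seminorm_mult extended_seminorm_add extended_seminorm_dual_norm
          extended_seminorm_sum_eval A)
    show "ennreal (norm (F \<phi>)) \<le> ?p \<phi>" if "\<phi> \<in> ?M" for \<phi>
      using that insert.prems(3)[of \<phi>] insert.hyps by simp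
  qed (use a submodule_annihilator dual_vector_space_record F in auto)
  then obtain G where G: "linear_functional (dual_space X) G" "\<And>\<phi>. \<phi> \<in> ?M \<Longrightarrow> G \<phi> = F \<phi>"
    "\<And>\<phi>. \<phi> \<in> carrier (dual_space X) \<Longrightarrow> ennreal (norm (G \<phi>)) \<le> ?p \<phi>" by blast
  obtain w where w: "w \<in> carrier X"
    "\<And>\<phi>. \<phi> \<in> carrier (dual_space X) \<Longrightarrow> ennreal (norm (G \<phi> - \<phi> w)) \<le> ennreal C * dual_norm X \<phi>"
    using insert.IH[OF A G(1) G(3)] by blast
  have "\<exists>c. \<forall>\<phi>\<in>carrier (dual_space X). F \<phi> - G \<phi> = c * \<phi> a"
  proof (cases "\<exists>\<phi>0\<in>carrier (dual_space X). \<phi>0 a \<noteq> 0")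
    case False then show ?thesis using G(2) by fastforce
  next
    case True
    then obtain \<phi>0 where \<phi>0: "\<phi>0 \<in> carrier (dual_space X)" "\<phi>0 a \<noteq> 0" by blast
    \<comment> \<open>\<open>F - G\<close> vanishes wherever the evaluation at \<open>a\<close>
      does, so it is a multiple of that evaluation, with the ratio read off at
      \<open>\<phi>0\<close>. Subtracting the right multiple of \<open>\<phi>0\<close> moves
      \<open>\<phi>\<close> into \<open>?M\<close>.\<close>
    have "F \<phi> - G \<phi> = (F \<phi>0 - G \<phi>0) / \<phi>0 a * \<phi> a" if \<phi>: "\<phi> \<in> carrier (dual_space X)" for \<phi>
    proof -
      let ?k = "- \<phi> a / \<phi>0 a"
      let ?\<eta> = "\<phi> \<oplus>\<^bsub>dual_space X\<^esub> ?k \<odot>\<^bsub>dual_space X\<^esub> \<phi>0"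
      have "?\<eta> \<in> carrier (dual_space X)" using \<phi> \<phi>0 by simp
      moreover have "?\<eta> a = 0" using a \<phi>0 by (simp add: dual_simps)
      ultimately have "G ?\<eta> = F ?\<eta>" using G(2) by blast
      then have "G \<phi> + ?k * G \<phi>0 = F \<phi> + ?k * F \<phi>0"
        using \<phi> \<phi>0 by (simp add: F linear_functionalD[OF G(1)])
      then show ?thesis using \<phi>0 by (simp add: field_simps)
    qed
    then show ?thesis by blast
  qed
  then obtain c where c: "\<And>\<phi>. \<phi> \<in> carrier (dual_space X) \<Longrightarrow> F \<phi> - G \<phi> = c * \<phi> a" by blast
  have "F \<phi> - \<phi> (w \<oplus> c \<odot> a) = G \<phi> - \<phi> w" if "\<phi> \<in> carrier (dual_space X)" for \<phi>
    using c[OF that] w a by (simp add: dual_linear[OF that] algebra_simps)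
  then show ?case using w a by (intro bexI[of _ "w \<oplus> c \<odot> a"]) auto
qed

lemma reflexive_enls_iff:
  fixes X :: "('k, 'a) enorm_space" (structure)
  assumes X: "enls X"
  shows "reflexive_enls X \<longleftrightarrow>
    (\<forall>F C. linear_functional (dual_space X) F \<longrightarrow>
      (\<forall>\<phi>\<in>carrier (dual_space X). ennreal (norm (F \<phi>)) \<le> ennreal C * dual_norm X \<phi>) \<longrightarrow>
      (\<exists>x\<in>carrier X. \<forall>\<phi>\<in>carrier (dual_space X). F \<phi> = \<phi> x))" (is "_ \<longleftrightarrow> ?R")
proof -
  interpret enls X by (rule X)
  show ?thesis
    unfolding reflexive_enls_iff_surj
  proof (intro iffI ballI allI impI)
    fix F C assume "\<forall>F\<in>carrier (bidual_space X). \<exists>x\<in>carrier X. \<forall>\<phi>\<in>carrier (dual_space X). F \<phi> = \<phi> x"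
      and "linear_functional (dual_space X) F"
      and "\<forall>\<phi>\<in>carrier (dual_space X). ennreal (norm (F \<phi>)) \<le> ennreal C * dual_norm X \<phi>"
    then show "\<exists>x\<in>carrier X. \<forall>\<phi>\<in>carrier (dual_space X). F \<phi> = \<phi> x"
      using bidual_memI[of F "{}" C] by simp
  next
    fix F assume R: ?R and F: "F \<in> carrier (bidual_space X)"
    have lin: "linear_functional (dual_space X) F" using F by (auto simp: dual_def)
    obtain A C where "finite A" "A \<subseteq> carrier X" "\<And>\<phi>. \<phi> \<in> carrier (dual_space X) \<Longrightarrow>
      ennreal (norm (F \<phi>)) \<le> ennreal C * (dual_norm X \<phi> + (\<Sum>a\<in>A. ennreal (norm (\<phi> a))))"
      using bidual_bound[OF F] by blast
    then obtain w where w: "w \<in> carrier X" "\<forall>\<phi>\<in>carrier (dual_space X).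
        ennreal (norm (F \<phi> - \<phi> w)) \<le> ennreal C * dual_norm X \<phi>"
      using split_off_evaluations[OF X _ _ lin] by blast
    let ?F = "\<lambda>\<phi>\<in>carrier (dual_space X). F \<phi> - \<phi> w"
    have "\<exists>x\<in>carrier X. \<forall>\<phi>\<in>carrier (dual_space X). ?F \<phi> = \<phi> x"
      using w by (intro R[rule_format, of ?F C] linear_functional_diff_eval lin) simp_all
    then obtain x where x: "x \<in> carrier X" "\<And>\<phi>. \<phi> \<in> carrier (dual_space X) \<Longrightarrow> F \<phi> - \<phi> w = \<phi> x"
      by auto
    then show "\<exists>x\<in>carrier X. \<forall>\<phi>\<in>carrier (dual_space X). F \<phi> = \<phi> x"
      using w by (intro bexI[of _ "x \<oplus> w"]) (auto simp: dual_linear algebra_simps diff_eq_eq)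
  qed
qed

text \<open>The functional sending \<open>c \<odot> x\<close> to \<open>c * d\<close> on the line
  through \<open>x\<close> is dominated by \<open>enorm X\<close>, so it extends. When
  \<open>enorm X x\<close> is infinite, \<open>d\<close> can be arbitrarily large while the dual
  norm stays at most 1.\<close>

lemma norming_functional:
  fixes X :: "('k, 'a) enorm_space" (structure)
  assumes X: "enls X" and x: "x \<in> carrier X" "x \<noteq> \<zero>" and d: "0 \<le> d" "ennreal d \<le> enorm X x"
  shows "\<exists>\<phi>\<in>carrier (dual_space X). \<phi> x = of_real d \<and> dual_norm X \<phi> \<le> 1"
proof -
  interpret enls X by (rule X)
  let ?M = "range (\<lambda>c. c \<odot> x)"
  \<comment> \<open>\<open>k\<close> reads off the coefficient along \<open>x\<close>; it is unique
    because \<open>x\<close> has nonzero norm.\<close>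
  define k where "k y = (THE c. y = c \<odot> x)" for y
  have k: "k (c \<odot> x) = c" for c
    unfolding k_def
  proof (rule the_equality)
    fix b assume b: "c \<odot> x = b \<odot> x"
    have "(c - b) \<odot> x = c \<odot> x \<ominus> b \<odot> x"
      using x smult_add_left[of x c "- b"] by (simp add: diff_eq_smult smult_smult)
    also have "\<dots> = \<zero>" using x unfolding b by (simp add: a_minus_def M.r_neg)
    finally have "ennreal (norm (c - b)) * enorm X x = 0"
      using enorm_smult[OF x(1), of "c - b"] by (simp add: enorm_zero)
    then show "b = c" using x enorm_eq_0D by auto
  qed simp
  have "\<exists>\<phi>. linear_functional X \<phi> \<and> (\<forall>y\<in>?M. \<phi> y = k y * of_real d) \<and>
      (\<forall>y\<in>carrier X. ennreal (norm (\<phi> y)) \<le> enorm X y)"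
  proof (rule hahn_banach[OF vector_space_record_axioms subspace_span_singleton[OF x(1)] extended_seminorm_enorm])
    fix y assume "y \<in> ?M"
    then obtain c where c: "y = c \<odot> x" by blast
    show "ennreal (norm (k y * of_real d)) \<le> enorm X y"
      using x d by (simp add: c k enorm_smult ennreal_norm_mult mult_left_mono)
    show "k (b \<odot> y) * of_real d = b * (k y * of_real d)" for b
      using x by (simp add: c k smult_smult)
    fix z assume "z \<in> ?M"
    then obtain b where b: "z = b \<odot> x" by blast
    show "k (y \<oplus> z) * of_real d = k y * of_real d + k z * of_real d"
      using x by (simp add: b c k smult_add_left[symmetric] distrib_right)
  qed
  then obtain \<phi> where \<phi>: "linear_functional X \<phi>" "\<And>y. y \<in> ?M \<Longrightarrow> \<phi> y = k y * of_real d"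
    "\<And>y. y \<in> carrier X \<Longrightarrow> ennreal (norm (\<phi> y)) \<le> enorm X y" by blast
  have dn: "dual_norm X \<phi> \<le> 1" using \<phi>(3) by (intro dual_norm_le) simp
  moreover have "\<phi> x = of_real d" using \<phi>(2)[OF rangeI, of 1] k[of 1] x by (simp add: smult_1)
  moreover have "\<phi> \<in> carrier (dual_space X)"
    using dn \<phi>(1) by (auto simp: mem_dual_iff intro: order_le_less_trans)
  ultimately show ?thesis by blast
qed

lemma separating_functional:
  fixes X :: "('k, 'a) enorm_space" (structure)
  assumes X: "enls X" and x: "x \<in> carrier X" "x \<noteq> \<zero>"
  shows "\<exists>\<phi>\<in>carrier (dual_space X). \<phi> x \<noteq> 0"
proof -
  interpret enls X by (rule X)
  have "0 < enorm X x" using x enorm_eq_0D zero_less_iff_neq_zero by blast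
  \<comment> \<open>The norm of \<open>x\<close> may be infinite, so a finite positive value below
    it is chosen.\<close>
  then obtain e where e: "0 < e" "e < enorm X x" using dense by blast
  then obtain d where d: "e = ennreal d" "0 \<le> d" by (cases e) auto
  have "d \<noteq> 0" using d e by auto
  moreover obtain \<phi> where "\<phi> \<in> carrier (dual_space X)" "\<phi> x = of_real d"
    using norming_functional[OF X x d(2)] d e by (metis less_imp_le)
  ultimately show ?thesis by (intro bexI[of _ \<phi>]) auto
qed

lemma dual_extend:
  fixes X :: "('k, 'a) enorm_space" (structure)
  assumes X: "enls X" and Y: "submodule Y cring_class_ops X"
    and \<psi>: "\<psi> \<in> carrier (dual_space (sub_enls X Y))"
  shows "\<exists>\<phi>\<in>carrier (dual_space X). (\<forall>y\<in>Y. \<phi> y = \<psi> y) \<and>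
    dual_norm X \<phi> \<le> dual_norm (sub_enls X Y) \<psi>"
proof -
  interpret enls X by (rule X)
  interpret S: enls "sub_enls X Y" by (rule enls_sub_enls[OF Y])
  let ?d = "dual_norm (sub_enls X Y) \<psi>"
  \<comment> \<open>The second summand matters only for \<open>?d = 0\<close>, where \<open>0 * \<infinity> = 0\<close> would force \<open>\<psi> = 0\<close>.\<close>
  let ?p = "\<lambda>x. ?d * enorm X x + (if enorm X x = \<infinity> then \<infinity> else 0)"
  have lin: "linear_functional (sub_enls X Y) \<psi>" and fin: "?d < \<infinity>"
    using \<psi> by (auto simp: S.mem_dual_iff)
  have simps: "carrier (sub_enls X Y) = Y" "enorm (sub_enls X Y) = enorm X"
    "(\<oplus>\<^bsub>sub_enls X Y\<^esub>) = (\<oplus>)" "(\<odot>\<^bsub>sub_enls X Y\<^esub>) = (\<odot>)"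
    by (simp_all add: sub_enls_def)
  have "\<exists>\<phi>. linear_functional X \<phi> \<and> (\<forall>y\<in>Y. \<phi> y = \<psi> y) \<and>
      (\<forall>x\<in>carrier X. ennreal (norm (\<phi> x)) \<le> ?p x)"
  proof (rule hahn_banach[OF vector_space_record_axioms Y])
    show "extended_seminorm X ?p"
      by (intro extended_seminorm_add extended_seminorm_mult extended_seminorm_enorm
          extended_seminorm_infinite)
    show "ennreal (norm (\<psi> y)) \<le> ?p y" if "y \<in> Y" for y
      using S.norm_le_dual_norm[OF lin, of y] that by (auto simp: simps less_top)
  qed (use linear_functionalD[OF lin] in \<open>auto simp: simps\<close>)
  then obtain \<phi> where \<phi>: "linear_functional X \<phi>" "\<forall>y\<in>Y. \<phi> y = \<psi> y"
    "\<And>x. x \<in> carrier X \<Longrightarrow> ennreal (norm (\<phi> x)) \<le> ?p x" by blast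
  have "dual_norm X \<phi> \<le> ?d"
  proof (rule dual_norm_le)
    fix x assume "x \<in> carrier X" "enorm X x < \<infinity>"
    then show "ennreal (norm (\<phi> x)) \<le> ?d * enorm X x" using \<phi>(3)[of x] by (auto split: if_splits)
  qed
  moreover then have "\<phi> \<in> carrier (dual_space X)"
    using fin \<phi>(1) by (auto simp: mem_dual_iff intro: order_le_less_trans)
  ultimately show ?thesis using \<phi> by blast
qed

end

section \<open>Closed subspaces and quotients\<close>

text \<open>Closedness enters through \<open>enls_quot_enls\<close>: only the zero coset then has
  quotient norm 0.\<close>

locale enls_closed_subspace = enls X
  for X :: "('k::real_normed_field, 'a) enorm_space" (structure) +
  fixes Y
  assumes subspace: "submodule Y cring_class_ops X"
    and closed: "closedin (enls_topology X) Y"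
begin

sublocale S: enls "sub_enls X Y"
  by (rule enls_sub_enls) (rule subspace)

sublocale Q: enls "quot_enls X Y"
  by (rule enls_quot_enls) (rule subspace closed)+

lemmas subspace_closed = subspaceD[OF subspace]
  and quot_simps = quot_enls_simps[OF subspace]

lemma sub_simps:
  "carrier (sub_enls X Y) = Y" "enorm (sub_enls X Y) = enorm X"
  "(\<oplus>\<^bsub>sub_enls X Y\<^esub>) = (\<oplus>)" "(\<odot>\<^bsub>sub_enls X Y\<^esub>) = (\<odot>)"
  by (simp_all add: sub_enls_def)

lemma coset_memD:
  assumes "z \<in> Y +> x" "x \<in> carrier X"
  obtains h where "h \<in> Y" "z = h \<oplus> x"
  using assms by (auto simp: a_r_coset_def')

lemma mem_own_coset: "x \<in> carrier X \<Longrightarrow> x \<in> Y +> x"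
  using subspace_closed by (force simp: a_r_coset_def')

lemma coset_eq_zero_iff:
  assumes "x \<in> carrier X"
  shows "Y +> x = \<zero>\<^bsub>quot_enls X Y\<^esub> \<longleftrightarrow> x \<in> Y"
proof -
  interpret A: abelian_subgroup Y X
    by (rule abelian_subgroupI3[OF _ M.abelian_group_axioms])
      (simp add: additive_subgroup.intro submodule.axioms(1)[OF subspace])
  have "Y +> x = Y \<longleftrightarrow> x \<in> Y"
    using assms A.a_rcos_const mem_own_coset by blast
  then show ?thesis by (simp add: quot_enls_def)
qed

lemma coset_diff:
  assumes "x \<in> carrier X" "y \<in> Y"
  shows "Y +> (x \<ominus> y) = Y +> x"
proof -
  have y: "y \<in> carrier X" "(- 1) \<odot> y \<in> Y" using assms subspace_closed by auto
  have "Y +> (x \<ominus> y) = (Y +> x) \<oplus>\<^bsub>quot_enls X Y\<^esub> (Y +> (- 1) \<odot> y)"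
    using assms y by (simp add: diff_eq_smult quot_simps)
  also have "Y +> (- 1) \<odot> y = \<zero>\<^bsub>quot_enls X Y\<^esub>" using y by (simp add: coset_eq_zero_iff)
  also have "(Y +> x) \<oplus>\<^bsub>quot_enls X Y\<^esub> \<dots> = Y +> x"
    using assms by (intro Q.M.r_zero) (simp add: quot_simps)
  finally show ?thesis .
qed

lemma enorm_coset_less_iff:
  assumes "x \<in> carrier X"
  shows "enorm (quot_enls X Y) (Y +> x) < c \<longleftrightarrow> (\<exists>y\<in>Y. enorm X (x \<ominus> y) < c)"
  by (simp add: enorm_quot_enls[OF subspace assms] INF_less_iff)

text \<open>An infimum below 1 is witnessed by a representative of norm below 1. For closed balls
  this could fail, as the infimum may not be attained.\<close>

lemma quot_unit_ball:
  "{C \<in> carrier (quot_enls X Y). enorm (quot_enls X Y) C < 1} =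
   (\<lambda>x. Y +> x) ` {x \<in> carrier X. enorm X x < 1}" (is "?L = ?R")
proof
  show "?L \<subseteq> ?R"
  proof
    fix C assume "C \<in> ?L"
    then obtain x where x: "x \<in> carrier X" "C = Y +> x" "enorm (quot_enls X Y) (Y +> x) < 1"
      by (auto simp: quot_simps)
    then obtain y where y: "y \<in> Y" "enorm X (x \<ominus> y) < 1" by (auto simp: enorm_coset_less_iff)
    moreover have "y \<in> carrier X" using y subspace_closed by auto
    ultimately show "C \<in> ?R" using x coset_diff[OF x(1) y(1)] by (intro image_eqI[of _ _ "x \<ominus> y"]) auto
  qed
  show "?R \<subseteq> ?L"
  proof
    fix C assume "C \<in> ?R"
    then obtain x where x: "x \<in> carrier X" "C = Y +> x" "enorm X x < 1" by auto
    have "x \<ominus> \<zero> = x" using x by (simp add: a_minus_def)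
    then have "enorm (quot_enls X Y) (Y +> x) < 1"
      unfolding enorm_coset_less_iff[OF x(1)] using subspace_closed(2) x
      by (intro bexI[of _ \<zero>]) auto
    then show "C \<in> ?L" using x by (auto simp: quot_simps)
  qed
qed

text \<open>The adjoint of the quotient map. The following lemmas show that it preserves the dual
  norm and maps the dual of the quotient bijectively onto the annihilator of
  \<open>Y\<close>.\<close>

definition pull :: "('a set \<Rightarrow> 'k) \<Rightarrow> 'a \<Rightarrow> 'k" where
  "pull \<psi> = (\<lambda>x\<in>carrier X. \<psi> (Y +> x))"

lemma dual_norm_pull: "dual_norm X (pull \<psi>) = dual_norm (quot_enls X Y) \<psi>"
  by (simp add: dual_norm_def quot_unit_ball sup_seminorm_def pull_def image_image)

lemma pull_mem_dual:
  assumes "\<psi> \<in> carrier (dual_space (quot_enls X Y))"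
  shows "pull \<psi> \<in> carrier (dual_space X)"
proof -
  have "linear_functional X (pull \<psi>)"
    unfolding pull_def
  proof (rule linear_functional_restrict)
    show "\<psi> (Y +> (x \<oplus> y)) = \<psi> (Y +> x) + \<psi> (Y +> y)" if "x \<in> carrier X" "y \<in> carrier X" for x y
      using Q.dual_linear(1)[OF assms, of "Y +> x" "Y +> y"] that by (simp add: quot_simps)
    show "\<psi> (Y +> (c \<odot> x)) = c * \<psi> (Y +> x)" if "x \<in> carrier X" for c x
      using Q.dual_linear(2)[OF assms, of "Y +> x" c] that by (simp add: quot_simps)
  qed
  then show ?thesis using assms by (simp add: mem_dual_iff Q.mem_dual_iff dual_norm_pull)
qed

lemma pull_zero_on_subspace:
  assumes "\<psi> \<in> carrier (dual_space (quot_enls X Y))" "y \<in> Y"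
  shows "pull \<psi> y = 0"
proof -
  have "y \<in> carrier X" using assms subspace_closed by auto
  then have "pull \<psi> y = \<psi> \<zero>\<^bsub>quot_enls X Y\<^esub>"
    using assms coset_eq_zero_iff[of y] by (simp add: pull_def)
  then show ?thesis using Q.dual_linear(4)[OF assms(1)] by simp
qed

lemma pull_add:
  "pull (\<phi> \<oplus>\<^bsub>dual_space (quot_enls X Y)\<^esub> \<psi>) = pull \<phi> \<oplus>\<^bsub>dual_space X\<^esub> pull \<psi>"
  by (auto simp: pull_def dual_simps quot_simps intro!: restrict_ext)

lemma pull_smult:
  "pull (c \<odot>\<^bsub>dual_space (quot_enls X Y)\<^esub> \<phi>) = c \<odot>\<^bsub>dual_space X\<^esub> pull \<phi>"
  by (auto simp: pull_def dual_simps quot_simps intro!: restrict_ext)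

lemma inj_on_pull: "inj_on pull (carrier (dual_space (quot_enls X Y)))"
proof (rule inj_onI)
  fix \<phi> \<psi> assume in_dual: "\<phi> \<in> carrier (dual_space (quot_enls X Y))" "\<psi> \<in> carrier (dual_space (quot_enls X Y))"
    and eq: "pull \<phi> = pull \<psi>"
  have "\<phi> (Y +> x) = \<psi> (Y +> x)" if "x \<in> carrier X" for x
    using fun_cong[OF eq, of x] that by (simp add: pull_def)
  then show "\<phi> = \<psi>" using in_dual by (intro Q.dual_eqI) (auto simp: quot_simps)
qed

lemma submodule_range_pull:
  "submodule (pull ` carrier (dual_space (quot_enls X Y))) cring_class_ops (dual_space X)"
proof (rule D.subspaceI)
  let ?M = "pull ` carrier (dual_space (quot_enls X Y))"
  show "?M \<subseteq> carrier (dual_space X)" using pull_mem_dual by blast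
  have "pull \<zero>\<^bsub>dual_space (quot_enls X Y)\<^esub> = \<zero>\<^bsub>dual_space X\<^esub>"
    by (auto simp: pull_def dual_simps quot_simps intro!: restrict_ext)
  then show "\<zero>\<^bsub>dual_space X\<^esub> \<in> ?M" by (metis Q.D.M.zero_closed imageI)
  show "\<phi> \<oplus>\<^bsub>dual_space X\<^esub> \<psi> \<in> ?M" if \<phi>: "\<phi> \<in> ?M" and \<psi>: "\<psi> \<in> ?M" for \<phi> \<psi>
  proof -
    obtain f g where "f \<in> carrier (dual_space (quot_enls X Y))" "\<phi> = pull f"
      "g \<in> carrier (dual_space (quot_enls X Y))" "\<psi> = pull g" using \<phi> \<psi> by blast
    then show ?thesis
      by (intro image_eqI[of _ _ "f \<oplus>\<^bsub>dual_space (quot_enls X Y)\<^esub> g"]) (simp_all add: pull_add)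
  qed
  show "c \<odot>\<^bsub>dual_space X\<^esub> \<phi> \<in> ?M" if \<phi>: "\<phi> \<in> ?M" for c \<phi>
  proof -
    obtain f where "f \<in> carrier (dual_space (quot_enls X Y))" "\<phi> = pull f" using \<phi> by blast
    then show ?thesis
      by (intro image_eqI[of _ _ "c \<odot>\<^bsub>dual_space (quot_enls X Y)\<^esub> f"]) (simp_all add: pull_smult)
  qed
qed

text \<open>A functional that kills \<open>Y\<close> is constant on cosets, so the chosen
  representative is immaterial; continuity on the quotient follows from
  \<open>dual_norm_pull\<close>.\<close>

lemma annihilator_eq_pull:
  assumes \<phi>: "\<phi> \<in> carrier (dual_space X)" and zero: "\<And>y. y \<in> Y \<Longrightarrow> \<phi> y = 0"
  shows "\<exists>\<psi>\<in>carrier (dual_space (quot_enls X Y)). pull \<psi> = \<phi>"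
proof -
  define \<psi> where "\<psi> = (\<lambda>C\<in>carrier (quot_enls X Y). \<phi> (SOME x. x \<in> carrier X \<and> C = Y +> x))"
  have coset: "\<psi> (Y +> x) = \<phi> x" if x: "x \<in> carrier X" for x
  proof -
    have "\<phi> (SOME z. z \<in> carrier X \<and> Y +> x = Y +> z) = \<phi> x"
    proof (rule someI2[where a = x])
      fix z assume z: "z \<in> carrier X \<and> Y +> x = Y +> z"
      then have "x \<in> Y +> z" using mem_own_coset[OF x] by simp
      then obtain h where h: "h \<in> Y" "x = h \<oplus> z" using z coset_memD by blast
      then have "h \<in> carrier X" using subspace_closed by blast
      then show "\<phi> z = \<phi> x" using h z zero[OF h(1)] dual_linear(1)[OF \<phi>] by simp
    qed (use x in auto)
    then show ?thesis using x by (simp add: \<psi>_def quot_simps)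
  qed
  have "linear_functional (quot_enls X Y) \<psi>"
    unfolding linear_functional_def
  proof (intro conjI ballI allI)
    show "\<psi> \<in> extensional (carrier (quot_enls X Y))" by (simp add: \<psi>_def)
  next
    fix C E assume "C \<in> carrier (quot_enls X Y)" "E \<in> carrier (quot_enls X Y)"
    then obtain x z where "x \<in> carrier X" "C = Y +> x" "z \<in> carrier X" "E = Y +> z"
      by (auto simp: quot_simps)
    then show "\<psi> (C \<oplus>\<^bsub>quot_enls X Y\<^esub> E) = \<psi> C + \<psi> E"
      by (simp add: quot_simps coset dual_linear(1)[OF \<phi>])
  next
    fix c C assume "C \<in> carrier (quot_enls X Y)"
    then obtain x where "x \<in> carrier X" "C = Y +> x" by (auto simp: quot_simps)
    then show "\<psi> (c \<odot>\<^bsub>quot_enls X Y\<^esub> C) = c * \<psi> C"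
      by (simp add: quot_simps coset dual_linear(2)[OF \<phi>])
  qed
  moreover have "pull \<psi> = restrict \<phi> (carrier X)"
    unfolding pull_def by (rule restrict_ext) (simp add: coset)
  then have "pull \<psi> = \<phi>" by (simp add: dual_restrict[OF \<phi>])
  ultimately show ?thesis
    using \<phi> dual_norm_pull[of \<psi>] by (auto simp: Q.mem_dual_iff mem_dual_iff)
qed

lemma dual_norm_restrict_le: "dual_norm (sub_enls X Y) (restrict \<phi> Y) \<le> dual_norm X \<phi>"
proof -
  have "dual_norm (sub_enls X Y) (restrict \<phi> Y) = sup_seminorm {x \<in> Y. enorm X x < 1} \<phi>"
    unfolding dual_norm_def sub_simps by (rule sup_seminorm_cong) auto
  also have "\<dots> \<le> dual_norm X \<phi>"
    unfolding dual_norm_def using subspace_closed by (intro sup_seminorm_mono) auto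
  finally show ?thesis .
qed

lemma restrict_mem_dual:
  assumes "\<phi> \<in> carrier (dual_space X)"
  shows "restrict \<phi> Y \<in> carrier (dual_space (sub_enls X Y))"
proof -
  have "linear_functional (sub_enls X Y) (restrict \<phi> Y)"
    using dual_linear[OF assms] subspace_closed
    by (auto simp: linear_functional_def sub_simps subset_iff)
  moreover have "dual_norm (sub_enls X Y) (restrict \<phi> Y) < \<infinity>"
    using dual_norm_restrict_le[of \<phi>] assms by (auto simp: mem_dual_iff intro: order_le_less_trans)
  ultimately show ?thesis by (simp add: S.mem_dual_iff)
qed

end

section \<open>Reflexivity of subspaces and quotients, and the three-space argument\<close>

context scalar_real_part
begin

text \<open>Composing \<open>F\<close> with restriction to \<open>Y\<close> gives a functional on
  the dual of \<open>X\<close>, dominated because restriction does not increase the dual norm. Its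
  representing point lies in \<open>Y\<close> and, as every functional on \<open>Y\<close> extends,
  represents \<open>F\<close>.\<close>

lemma reflexive_sub_enls:
  fixes X :: "('k, 'a) enorm_space" (structure)
  assumes XY: "enls_closed_subspace X Y" and refl: "reflexive_enls X"
  shows "reflexive_enls (sub_enls X Y)"
proof -
  interpret enls_closed_subspace X Y by (rule XY)
  show ?thesis
    unfolding reflexive_enls_iff[OF S.enls_axioms]
  proof (intro allI impI)
    fix F C
    assume F: "linear_functional (dual_space (sub_enls X Y)) F"
      and bound: "\<forall>\<psi>\<in>carrier (dual_space (sub_enls X Y)).
        ennreal (norm (F \<psi>)) \<le> ennreal C * dual_norm (sub_enls X Y) \<psi>"
    let ?F = "\<lambda>\<phi>\<in>carrier (dual_space X). F (restrict \<phi> Y)"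
    have "\<exists>x\<in>carrier X. \<forall>\<phi>\<in>carrier (dual_space X). ?F \<phi> = \<phi> x"
    proof (rule refl[unfolded reflexive_enls_iff[OF enls_axioms], rule_format, of ?F C])
      show "linear_functional (dual_space X) ?F"
      proof (rule D.linear_functional_restrict)
        show "F (restrict (\<phi> \<oplus>\<^bsub>dual_space X\<^esub> \<psi>) Y) = F (restrict \<phi> Y) + F (restrict \<psi> Y)"
          if "\<phi> \<in> carrier (dual_space X)" "\<psi> \<in> carrier (dual_space X)" for \<phi> \<psi>
        proof -
          have "restrict (\<phi> \<oplus>\<^bsub>dual_space X\<^esub> \<psi>) Y =
              restrict \<phi> Y \<oplus>\<^bsub>dual_space (sub_enls X Y)\<^esub> restrict \<psi> Y"
            using subspace_closed by (auto simp: dual_simps sub_simps fun_eq_iff)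
          then show ?thesis using that by (simp add: linear_functionalD(2)[OF F] restrict_mem_dual)
        qed
        show "F (restrict (c \<odot>\<^bsub>dual_space X\<^esub> \<phi>) Y) = c * F (restrict \<phi> Y)"
          if "\<phi> \<in> carrier (dual_space X)" for c \<phi>
        proof -
          have "restrict (c \<odot>\<^bsub>dual_space X\<^esub> \<phi>) Y =
              c \<odot>\<^bsub>dual_space (sub_enls X Y)\<^esub> restrict \<phi> Y"
            using subspace_closed by (auto simp: dual_simps sub_simps fun_eq_iff)
          then show ?thesis using that by (simp add: linear_functionalD(3)[OF F] restrict_mem_dual)
        qed
      qed
      fix \<phi> assume \<phi>: "\<phi> \<in> carrier (dual_space X)"
      then have "ennreal (norm (?F \<phi>)) \<le> ennreal C * dual_norm (sub_enls X Y) (restrict \<phi> Y)"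
        using bound restrict_mem_dual by simp
      also have "\<dots> \<le> ennreal C * dual_norm X \<phi>"
        by (intro mult_left_mono dual_norm_restrict_le) simp
      finally show "ennreal (norm (?F \<phi>)) \<le> ennreal C * dual_norm X \<phi>" .
    qed
    then obtain x where x: "x \<in> carrier X"
      "\<And>\<phi>. \<phi> \<in> carrier (dual_space X) \<Longrightarrow> F (restrict \<phi> Y) = \<phi> x" by auto
    \<comment> \<open>Otherwise a functional on the quotient separates the coset of \<open>x\<close>
      from zero; its pullback restricts to zero on \<open>Y\<close> but not to zero at
      \<open>x\<close>.\<close>
    have "x \<in> Y"
    proof (rule ccontr)
      assume "x \<notin> Y"
      then obtain \<psi> where \<psi>: "\<psi> \<in> carrier (dual_space (quot_enls X Y))" "\<psi> (Y +> x) \<noteq> 0"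
        using separating_functional[OF Q.enls_axioms, of "Y +> x"] x coset_eq_zero_iff
        by (auto simp: quot_simps(1))
      have "restrict (pull \<psi>) Y = \<zero>\<^bsub>dual_space (sub_enls X Y)\<^esub>"
        using pull_zero_on_subspace[OF \<psi>(1)] by (auto simp: dual_simps sub_simps intro!: restrict_ext)
      then have "pull \<psi> x = 0"
        using x(2)[OF pull_mem_dual[OF \<psi>(1)]] S.D.linear_functional_zero[OF F] by simp
      then show False using \<psi> x by (simp add: pull_def)
    qed
    moreover have "F \<psi> = \<psi> x" if \<psi>: "\<psi> \<in> carrier (dual_space (sub_enls X Y))" for \<psi>
    proof -
      obtain \<phi> where \<phi>: "\<phi> \<in> carrier (dual_space X)" "\<And>y. y \<in> Y \<Longrightarrow> \<phi> y = \<psi> y"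
        using dual_extend[OF enls_axioms subspace \<psi>] by blast
      have "restrict \<phi> Y = \<psi>"
        using \<phi> \<psi> by (intro S.dual_eqI restrict_mem_dual) (auto simp: sub_simps)
      then show ?thesis using x(2)[OF \<phi>(1)] \<phi>(2) \<open>x \<in> Y\<close> by simp
    qed
    ultimately show "\<exists>x\<in>carrier (sub_enls X Y). \<forall>\<psi>\<in>carrier (dual_space (sub_enls X Y)). F \<psi> = \<psi> x"
      by (auto simp: sub_simps)
  qed
qed

text \<open>Transport \<open>G\<close> to the annihilator of \<open>Y\<close> along
  \<open>pull\<close> and extend it by Hahn-Banach on the dual space itself, dominated by
  \<open>C\<close> times the dual norm. The coset of the point representing the extension represents
  \<open>G\<close>.\<close>

lemma reflexive_quot_enls:
  fixes X :: "('k, 'a) enorm_space" (structure)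
  assumes XY: "enls_closed_subspace X Y" and refl: "reflexive_enls X"
  shows "reflexive_enls (quot_enls X Y)"
proof -
  interpret enls_closed_subspace X Y by (rule XY)
  show ?thesis
    unfolding reflexive_enls_iff[OF Q.enls_axioms]
  proof (intro allI impI)
    let ?Q = "dual_space (quot_enls X Y)"
    fix G C
    assume G: "linear_functional ?Q G"
      and bound: "\<forall>\<psi>\<in>carrier ?Q. ennreal (norm (G \<psi>)) \<le> ennreal C * dual_norm (quot_enls X Y) \<psi>"
    let ?f = "\<lambda>\<phi>. G (inv_into (carrier ?Q) pull \<phi>)"
    have f: "?f (pull \<psi>) = G \<psi>" if "\<psi> \<in> carrier ?Q" for \<psi>
      using inv_into_f_f[OF inj_on_pull that] by simp
    have "\<exists>F. linear_functional (dual_space X) F \<and> (\<forall>\<phi>\<in>pull ` carrier ?Q. F \<phi> = ?f \<phi>) \<and>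
        (\<forall>\<phi>\<in>carrier (dual_space X). ennreal (norm (F \<phi>)) \<le> ennreal C * dual_norm X \<phi>)"
    proof (rule hahn_banach[OF dual_vector_space_record submodule_range_pull])
      show "extended_seminorm (dual_space X) (\<lambda>\<phi>. ennreal C * dual_norm X \<phi>)"
        by (intro extended_seminorm_mult extended_seminorm_dual_norm)
      fix \<phi> assume "\<phi> \<in> pull ` carrier ?Q"
      then obtain \<psi> where \<psi>: "\<psi> \<in> carrier ?Q" "\<phi> = pull \<psi>" by blast
      show "ennreal (norm (?f \<phi>)) \<le> ennreal C * dual_norm X \<phi>"
        using \<psi> bound by (simp add: f dual_norm_pull)
      show "?f (c \<odot>\<^bsub>dual_space X\<^esub> \<phi>) = c * ?f \<phi>" for c
        using \<psi> by (simp add: f linear_functionalD(3)[OF G] flip: pull_smult)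
      fix \<eta> assume "\<eta> \<in> pull ` carrier ?Q"
      then obtain \<theta> where \<theta>: "\<theta> \<in> carrier ?Q" "\<eta> = pull \<theta>" by blast
      show "?f (\<phi> \<oplus>\<^bsub>dual_space X\<^esub> \<eta>) = ?f \<phi> + ?f \<eta>"
        using \<psi> \<theta> by (simp add: f linear_functionalD(2)[OF G] flip: pull_add)
    qed
    then obtain F where F: "linear_functional (dual_space X) F" "\<And>\<psi>. \<psi> \<in> carrier ?Q \<Longrightarrow> F (pull \<psi>) = G \<psi>"
      "\<forall>\<phi>\<in>carrier (dual_space X). ennreal (norm (F \<phi>)) \<le> ennreal C * dual_norm X \<phi>"
      by (auto simp: f)
    have "\<exists>x\<in>carrier X. \<forall>\<phi>\<in>carrier (dual_space X). F \<phi> = \<phi> x"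
      by (rule refl[unfolded reflexive_enls_iff[OF enls_axioms], rule_format, of F C])
        (use F in auto)
    then obtain x where x: "x \<in> carrier X" "\<And>\<phi>. \<phi> \<in> carrier (dual_space X) \<Longrightarrow> F \<phi> = \<phi> x"
      by blast
    have "G \<psi> = \<psi> (Y +> x)" if "\<psi> \<in> carrier ?Q" for \<psi>
      using x F(2)[OF that] pull_mem_dual[OF that] by (simp add: pull_def)
    then show "\<exists>D\<in>carrier (quot_enls X Y). \<forall>\<psi>\<in>carrier ?Q. G \<psi> = \<psi> D"
      using x by (auto simp: quot_simps)
  qed
qed

text \<open>Reflexivity of the quotient represents \<open>F\<close> on the annihilator of
  \<open>Y\<close> by a point \<open>x\<close> of finite norm. The rest \<open>E = F - x\<close>
  kills the annihilator, hence descends to the dual of \<open>Y\<close>, where reflexivity yields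
  \<open>y\<close>; then \<open>x \<oplus> y\<close> represents \<open>F\<close>.\<close>

lemma reflexive_of_sub_quot:
  fixes X :: "('k, 'a) enorm_space" (structure)
  assumes XY: "enls_closed_subspace X Y"
    and refl_sub: "reflexive_enls (sub_enls X Y)" and refl_quot: "reflexive_enls (quot_enls X Y)"
  shows "reflexive_enls X"
proof -
  interpret enls_closed_subspace X Y by (rule XY)
  show ?thesis
    unfolding reflexive_enls_iff[OF enls_axioms]
  proof (intro allI impI)
    let ?Q = "dual_space (quot_enls X Y)" and ?S = "dual_space (sub_enls X Y)"
    fix F C
    assume F: "linear_functional (dual_space X) F"
      and bound: "\<forall>\<phi>\<in>carrier (dual_space X). ennreal (norm (F \<phi>)) \<le> ennreal C * dual_norm X \<phi>"
    let ?G = "\<lambda>\<psi>\<in>carrier ?Q. F (pull \<psi>)"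
    have G_bound: "ennreal (norm (F (pull \<psi>))) \<le> ennreal C * dual_norm (quot_enls X Y) \<psi>"
      if "\<psi> \<in> carrier ?Q" for \<psi>
      using bound pull_mem_dual[OF that] by (simp flip: dual_norm_pull)
    have "\<exists>D\<in>carrier (quot_enls X Y). \<forall>\<psi>\<in>carrier ?Q. ?G \<psi> = \<psi> D"
    proof (rule refl_quot[unfolded reflexive_enls_iff[OF Q.enls_axioms], rule_format, of ?G C])
      show "linear_functional ?Q ?G"
        by (rule Q.D.linear_functional_restrict)
          (simp_all add: pull_add pull_smult linear_functionalD[OF F] pull_mem_dual)
    qed (use G_bound in simp)
    then obtain x0 where x0: "x0 \<in> carrier X"
      "\<And>\<psi>. \<psi> \<in> carrier ?Q \<Longrightarrow> F (pull \<psi>) = \<psi> (Y +> x0)"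
      by (auto simp: quot_simps)
    \<comment> \<open>If it were infinite, some functional of dual norm at most 1 would take the
      value \<open>\<bar>C\<bar> + 1\<close> on the coset, against the bound \<open>C\<close> on
      \<open>F\<close>.\<close>
    have "enorm (quot_enls X Y) (Y +> x0) < \<infinity>"
    proof (rule ccontr)
      assume "\<not> ?thesis"
      then have inf: "enorm (quot_enls X Y) (Y +> x0) = \<infinity>" by (simp add: less_top[symmetric])
      then have "Y +> x0 \<noteq> \<zero>\<^bsub>quot_enls X Y\<^esub>" using Q.enorm_zero by auto
      then obtain \<psi> where \<psi>: "\<psi> \<in> carrier ?Q" "\<psi> (Y +> x0) = of_real (\<bar>C\<bar> + 1)"
        "dual_norm (quot_enls X Y) \<psi> \<le> 1"
        using norming_functional[OF Q.enls_axioms, of "Y +> x0" "\<bar>C\<bar> + 1"] x0(1) inf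
        by (auto simp: quot_simps(1))
      have "ennreal (\<bar>C\<bar> + 1) = ennreal (norm (F (pull \<psi>)))"
        unfolding x0(2)[OF \<psi>(1)] \<psi>(2) norm_of_real by simp
      also have "\<dots> \<le> ennreal C * dual_norm (quot_enls X Y) \<psi>" by (rule G_bound) (rule \<psi>)
      also have "\<dots> \<le> ennreal \<bar>C\<bar> * 1" by (intro mult_mono \<psi> ennreal_leI) auto
      finally show False by (simp del: ennreal_plus)
    qed
    then obtain y0 where y0: "y0 \<in> Y" "enorm X (x0 \<ominus> y0) < \<infinity>"
      using x0 by (auto simp: enorm_coset_less_iff)
    define x where "x = x0 \<ominus> y0"
    have x: "x \<in> carrier X" using x0 y0 subspace_closed by (auto simp: x_def)
    have Fx: "F (pull \<psi>) = pull \<psi> x" if "\<psi> \<in> carrier ?Q" for \<psi>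
      using x0(2)[OF that] x coset_diff[OF x0(1) y0(1)] by (simp add: pull_def x_def)
    obtain t where t: "enorm X x = ennreal t" "0 \<le> t"
      using y0 by (cases "enorm X (x0 \<ominus> y0)") (auto simp: x_def)
    define E where "E = (\<lambda>\<phi>\<in>carrier (dual_space X). F \<phi> - \<phi> x)"
    have E: "linear_functional (dual_space X) E"
      unfolding E_def by (rule linear_functional_diff_eval[OF F x])
    \<comment> \<open>Finiteness of \<open>t\<close> keeps the rest dominated by the dual norm. The
      absolute value is taken because \<open>C\<close> may be negative, with
      \<open>ennreal C = 0\<close>, and would then lower the sum.\<close>
    have E_bound: "ennreal (norm (E \<phi>)) \<le> ennreal (\<bar>C\<bar> + t) * dual_norm X \<phi>"
      if \<phi>: "\<phi> \<in> carrier (dual_space X)" for \<phi>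
    proof -
      have F_le: "ennreal (norm (F \<phi>)) \<le> ennreal \<bar>C\<bar> * dual_norm X \<phi>"
      proof -
        have "ennreal C * dual_norm X \<phi> \<le> ennreal \<bar>C\<bar> * dual_norm X \<phi>"
          by (intro mult_right_mono ennreal_leI) auto
        then show ?thesis using bound \<phi> order_trans by blast
      qed
      have ev_le: "ennreal (norm (\<phi> x)) \<le> dual_norm X \<phi> * ennreal t"
        using norm_le_dual_norm[of \<phi> x] \<phi> x t by (simp add: mem_dual_iff)
      have "ennreal (norm (E \<phi>)) \<le> ennreal (norm (F \<phi>)) + ennreal (norm (\<phi> x))"
        using \<phi> ennreal_norm_triangle[of "F \<phi>" "- \<phi> x"] by (simp add: E_def)
      also have "\<dots> \<le> ennreal \<bar>C\<bar> * dual_norm X \<phi> + dual_norm X \<phi> * ennreal t"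
        by (intro add_mono F_le ev_le)
      also have "\<dots> = ennreal (\<bar>C\<bar> + t) * dual_norm X \<phi>"
        using t by (simp add: distrib_left mult.commute)
      finally show ?thesis .
    qed
    \<comment> \<open>The difference of two functionals agreeing on \<open>Y\<close> is a pullback
      from the quotient, where \<open>F\<close> and evaluation at \<open>x\<close> coincide.\<close>
    have E_cong: "E \<phi> = E \<phi>'"
      if in_dual: "\<phi> \<in> carrier (dual_space X)" "\<phi>' \<in> carrier (dual_space X)"
        and eq: "\<And>y. y \<in> Y \<Longrightarrow> \<phi> y = \<phi>' y" for \<phi> \<phi>'
    proof -
      let ?d = "\<phi> \<oplus>\<^bsub>dual_space X\<^esub> (- 1) \<odot>\<^bsub>dual_space X\<^esub> \<phi>'"
      have d: "?d \<in> carrier (dual_space X)" using in_dual by simp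
      moreover have "?d y = 0" if "y \<in> Y" for y
        using that subspace_closed eq by (auto simp: dual_simps)
      ultimately obtain \<psi> where "\<psi> \<in> carrier ?Q" "pull \<psi> = ?d"
        using annihilator_eq_pull by blast
      then have "E ?d = 0" using Fx[of \<psi>] d by (simp add: E_def)
      then show ?thesis using in_dual by (simp add: linear_functionalD[OF E])
    qed
    \<comment> \<open>The extensions are merely chosen, so \<open>e\<close> need not be linear. By
      \<open>E_cong\<close> the value \<open>E (e \<psi>)\<close> does not depend on the choice,
      which makes \<open>?H\<close> linear; the norm bound on \<open>e\<close> makes it
      dominated.\<close>
    have "\<forall>\<psi>\<in>carrier ?S. \<exists>\<phi>. \<phi> \<in> carrier (dual_space X) \<and> (\<forall>y\<in>Y. \<phi> y = \<psi> y) \<and>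
        dual_norm X \<phi> \<le> dual_norm (sub_enls X Y) \<psi>"
      using dual_extend[OF enls_axioms subspace] by blast
    then obtain e where e: "\<And>\<psi>. \<psi> \<in> carrier ?S \<Longrightarrow> e \<psi> \<in> carrier (dual_space X)"
      "\<And>\<psi> y. \<lbrakk>\<psi> \<in> carrier ?S; y \<in> Y\<rbrakk> \<Longrightarrow> e \<psi> y = \<psi> y"
      "\<And>\<psi>. \<psi> \<in> carrier ?S \<Longrightarrow> dual_norm X (e \<psi>) \<le> dual_norm (sub_enls X Y) \<psi>"
      by metis
    let ?H = "\<lambda>\<psi>\<in>carrier ?S. E (e \<psi>)"
    have "\<exists>y\<in>carrier (sub_enls X Y). \<forall>\<psi>\<in>carrier ?S. ?H \<psi> = \<psi> y"
    proof (rule refl_sub[unfolded reflexive_enls_iff[OF S.enls_axioms], rule_format, of ?H "\<bar>C\<bar> + t"])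
      show "linear_functional ?S ?H"
      proof (rule S.D.linear_functional_restrict)
        show "E (e (\<phi> \<oplus>\<^bsub>?S\<^esub> \<psi>)) = E (e \<phi>) + E (e \<psi>)"
          if "\<phi> \<in> carrier ?S" "\<psi> \<in> carrier ?S" for \<phi> \<psi>
        proof -
          have "E (e (\<phi> \<oplus>\<^bsub>?S\<^esub> \<psi>)) = E (e \<phi> \<oplus>\<^bsub>dual_space X\<^esub> e \<psi>)"
          proof (rule E_cong)
            fix y assume y: "y \<in> Y"
            then have "y \<in> carrier X" using subspace_closed by blast
            have "e (\<phi> \<oplus>\<^bsub>?S\<^esub> \<psi>) y = (\<phi> \<oplus>\<^bsub>?S\<^esub> \<psi>) y"
              by (rule e(2)) (use that y in auto)
            then show "e (\<phi> \<oplus>\<^bsub>?S\<^esub> \<psi>) y = (e \<phi> \<oplus>\<^bsub>dual_space X\<^esub> e \<psi>) y"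
              using that y \<open>y \<in> carrier X\<close> by (simp add: e dual_simps sub_simps)
          qed (use that e(1) in auto)
          then show ?thesis using that by (simp add: linear_functionalD(2)[OF E] e)
        qed
        show "E (e (c \<odot>\<^bsub>?S\<^esub> \<phi>)) = c * E (e \<phi>)" if "\<phi> \<in> carrier ?S" for c \<phi>
        proof -
          have "E (e (c \<odot>\<^bsub>?S\<^esub> \<phi>)) = E (c \<odot>\<^bsub>dual_space X\<^esub> e \<phi>)"
          proof (rule E_cong)
            fix y assume y: "y \<in> Y"
            then have "y \<in> carrier X" using subspace_closed by blast
            have "e (c \<odot>\<^bsub>?S\<^esub> \<phi>) y = (c \<odot>\<^bsub>?S\<^esub> \<phi>) y"
              by (rule e(2)) (use that y in auto)
            then show "e (c \<odot>\<^bsub>?S\<^esub> \<phi>) y = (c \<odot>\<^bsub>dual_space X\<^esub> e \<phi>) y"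
              using that y \<open>y \<in> carrier X\<close> by (simp add: e dual_simps sub_simps)
          qed (use that e(1) in auto)
          then show ?thesis using that by (simp add: linear_functionalD(3)[OF E] e)
        qed
      qed
      fix \<psi> assume \<psi>: "\<psi> \<in> carrier ?S"
      have "ennreal (norm (?H \<psi>)) \<le> ennreal (\<bar>C\<bar> + t) * dual_norm X (e \<psi>)"
        using E_bound[OF e(1)[OF \<psi>]] \<psi> by (simp del: ennreal_plus)
      also have "\<dots> \<le> ennreal (\<bar>C\<bar> + t) * dual_norm (sub_enls X Y) \<psi>"
        by (intro mult_left_mono e \<psi>) simp
      finally show "ennreal (norm (?H \<psi>)) \<le> ennreal (\<bar>C\<bar> + t) * dual_norm (sub_enls X Y) \<psi>" .
    qed
    then obtain y where y: "y \<in> Y" "\<And>\<psi>. \<psi> \<in> carrier ?S \<Longrightarrow> E (e \<psi>) = \<psi> y"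
      by (auto simp: sub_simps(1))
    have yX: "y \<in> carrier X" using y subspace_closed by blast
    have "F \<phi> = \<phi> (x \<oplus> y)" if \<phi>: "\<phi> \<in> carrier (dual_space X)" for \<phi>
    proof -
      have r: "restrict \<phi> Y \<in> carrier ?S" by (rule restrict_mem_dual) (rule \<phi>)
      have "E \<phi> = E (e (restrict \<phi> Y))" by (rule E_cong) (use \<phi> r e in auto)
      also have "\<dots> = \<phi> y" using y r by simp
      finally show ?thesis using \<phi> x yX by (simp add: E_def dual_linear(1)[OF \<phi>] algebra_simps)
    qed
    then show "\<exists>x\<in>carrier X. \<forall>\<phi>\<in>carrier (dual_space X). F \<phi> = \<phi> x" using x yX by blast
  qed
qed

theorem reflexive_three_space:
  fixes X :: "('k, 'a) enorm_space"
  assumes "enls X" "submodule Y cring_class_ops X" "closedin (enls_topology X) Y"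
  shows "reflexive_enls X \<longleftrightarrow> reflexive_enls (sub_enls X Y) \<and> reflexive_enls (quot_enls X Y)"
proof -
  have "enls_closed_subspace X Y"
    using assms by (simp add: enls_closed_subspace_def enls_closed_subspace_axioms_def)
  then show ?thesis
    using reflexive_sub_enls reflexive_quot_enls reflexive_of_sub_quot by blast
qed

end

theorem theorem3p22:
  shows "(\<forall>(X :: (real, 'a) enorm_space) Y.
            enls X \<and> submodule Y cring_class_ops X \<and> closedin (enls_topology X) Y \<longrightarrow>
            (reflexive_enls X \<longleftrightarrow>
               reflexive_enls (sub_enls X Y) \<and> reflexive_enls (quot_enls X Y))) \<and>
         (\<forall>(X :: (complex, 'a) enorm_space) Y.
            enls X \<and> submodule Y cring_class_ops X \<and> closedin (enls_topology X) Y \<longrightarrow>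
            (reflexive_enls X \<longleftrightarrow>
               reflexive_enls (sub_enls X Y) \<and> reflexive_enls (quot_enls X Y)))"
proof (intro conjI allI impI, goal_cases)
  case (1 X Y)
  then show ?case
    by (intro scalar_real_part.reflexive_three_space[OF scalar_real_part_real]) simp_all
next
  case (2 X Y)
  then show ?case
    by (intro scalar_real_part.reflexive_three_space[OF scalar_real_part_Re]) simp_all
qed

end
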